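(* Suppose that $H$ is of the additively separable form $H(\mathbf x)=\theta+\sum_{n=1}^NH^n(x^n)$, and that Assumptions 1, 2 and 3 (stated in the context) hold for every $\omega\in\Omega$ and $T\in\mathbb N$. Let $\mathcal LH$ and $\mathcal L^\circ H$ be the exact and practical information relaxation bounds, $$\mathcal LH(\mathbf x_0)=H(\mathbf x_0)+\mathbb E\Big[\max_{\mathbf a\in\bar{\mathcal A}(\tau)}I_H(\mathbf a,\omega,\tau;0)\Big|\mathbf x_0\Big],\qquad \mathcal L^\circ H(\mathbf x_0)=H(\mathbf x_0)+\mathbb E\Big[\min_{\boldsymbol\mu\ge0}\max_{\mathbf a\in\mathcal A(\tau)}I_H(\mathbf a,\omega,\tau;\boldsymbol\mu)\Big|\mathbf x_0\Big],$$ where for $\boldsymbol\mu=(\boldsymbol\mu_0,\dots,\boldsymbol\mu_\tau)$, $\boldsymbol\mu_t\in\mathbb R^L_+$, $$I_H(\mathbf a,\omega,\tau;\boldsymbol\mu)=\sum_{t=0}^{\tau}\Big(R(\mathbf x_t,\mathbf a_t)+\beta\,\mathbb E[H(\mathbf x_{t+1})\mid\mathbf x_t,\mathbf a_t]-H(\mathbf x_t)+\boldsymbol\mu_t^\top[\mathbf b-\mathbf B(\mathbf x_t,\mathbf a_t)]\Big).$$ Then for all $\mathbf x\in\mathcal X$, $$\mathcal L^\circ H(\mathbf x)-\mathcal LH(\mathbf x)\le\frac{(L-1)\beta+L+1}{(1-\beta)^2}\max_{n=1,\dots,N}\Gamma^n,$$ where $$\Gamma^n=\sup_{x_0^n\in\mathcal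 X^n,\,a_0^n\in\mathcal A^n(x_0^n)}\{R^n(x_0^n,a_0^n)+\beta\,\mathbb E[H^n(x_1^n)\mid x_0^n,a_0^n]-H^n(x_0^n)\}-\inf_{x_0^n\in\mathcal X^n,\,a_0^n\in\mathcal A^n(x_0^n)}\{R^n(x_0^n,a_0^n)+\beta\,\mathbb E[H^n(x_1^n)\mid x_0^n,a_0^n]-H^n(x_0^n)\}.$$
   Context: Weakly coupled dynamic program. Fix integers $N,L\ge1$, a discount factor $\beta\in(0,1)$ and $\mathbf b\in\mathbb R^L$. For $n=1,\dots,N$, project $n$ has a state space $\mathcal X^n$, action sets $\mathcal A^n(x^n)$ (subsets of a Euclidean space) for $x^n\in\mathcal X^n$, a controlled transition kernel $P_n(\cdot\mid x^n,a^n)$, a bounded reward $R^n(x^n,a^n)\in\mathbb R$, and a constraint function $\mathbf B^n(x^n,a^n)\in\mathbb R^L$. Put $\mathcal X=\prod_n\mathcal X^n$, $\mathcal A(\mathbf x)=\prod_n\mathcal A^n(x^n)$, $R(\mathbf x,\mathbf a)=\sum_nR^n(x^n,a^n)$, $\mathbf B(\mathbf x,\mathbf a)=\sum_n\mathbf B^n(x^n,a^n)$, and $\bar{\mathcal A}(\mathbf x)=\{\mathbf a\in\mathcal A(\mathbf x):\mathbf B(\mathbf x,\mathbf a)\le\mathbf b\}$ (componentwise). The joint transition law is the product $P(\cdot\mid\mathbf x,\mathbf a)=\prod_nP_n(\cdot\mid x^n,a^n)$; $\mathbb E[H(\mathbf x_{t+1})\mid\mathbf x_t,\mathbf a_t]$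 denotes the integral of $H$ against $P(\cdot\mid\mathbf x_t,\mathbf a_t)$, and $\mathbb E[H^n(x^n_{t+1})\mid x^n_t,a^n_t]$ the integral of $H^n$ against $P_n(\cdot\mid x^n_t,a^n_t)$. The functions $H^n:\mathcal X^n\to\mathbb R$ are bounded and measurable and $\theta\in\mathbb R$. Scenarios. On a probability space $(\Omega,\mathcal F,P)$ the state of each project is a function of the scenario $\omega$ and of that project's past controls: $x^n_0=x^n_0(\omega)$, $x^n_{t+1}=x^n_{t+1}(a^n_0,\dots,a^n_t,\omega)$, and $\mathbf x_t=(x_t^1,\dots,x_t^N)$. $\tau$ is a random time with $P(\tau=t)=(1-\beta)\beta^t$, $t=0,1,2,\dots$, independent of $\omega$. For $T\in\mathbb N=\{0,1,\dots\}$ and a scenario $\omega$: $\mathcal A(T)$ (resp. $\bar{\mathcal A}(T)$) is the set of $(\mathbf a_0,\dots,\mathbf a_T)$ with $\mathbf a_t\in\mathcal A(\mathbf x_t)$ (resp. $\mathbf a_t\in\bar{\mathcal A}(\mathbf x_t)$) along the trajectory they generate, and $\mathcal A^n(T)$ is the set of $\mathbf a^n=(a^n_0,\dots,a^n_T)$ with $a^n_t\in\mathcal A^n(x^n_t)$ along the trajectory of project $n$ they generate. Optimizations are done for each fixed $(\omega,\tau)$, and the expectations are over both $\omega$ and $\tau$. Maxima and minima written are assumed to exist (otherwise read as suprema/infima) and to be measurable in $\omega$. For $\mathbf a^n\in\mathcal A^n(T)$ write $\mathbf B^n_t(\mathbf a^n,\omega)=\mathbf B^n(x^n_t,a^n_t)$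 ($0\le t\le T$) and $$I^n_{H^n}(\mathbf a^n,\omega,T)=\sum_{t=0}^T\big(R^n(x^n_t,a^n_t)+\beta\,\mathbb E[H^n(x^n_{t+1})\mid x^n_t,a^n_t]-H^n(x^n_t)\big).$$ Assumption 1: $\bar{\mathcal A}(\mathbf x)\ne\emptyset$ for every $\mathbf x\in\mathcal X$. Assumption 2 (for given $\omega,T$): for each $n=1,\dots,N$ the set $\{(\mathbf a^n,\mathbf B^n_0(\mathbf a^n,\omega),\dots,\mathbf B^n_T(\mathbf a^n,\omega),I^n_{H^n}(\mathbf a^n,\omega,T)):\mathbf a^n\in\mathcal A^n(T)\}$ is nonempty and compact. Assumption 3 (for given $\omega,T$): for each $n=1,\dots,N$ and every $\tilde{\mathbf a}^n\in\mathrm{conv}(\mathcal A^n(T))$ there exists $\mathbf a^n\in\mathcal A^n(T)$ such that $\mathbf B^n_t(\mathbf a^n,\omega)\le(\check{\mathrm{cl}}\,\mathbf B^n_t)(\tilde{\mathbf a}^n,\omega)$ componentwise for all $t=0,\dots,T$. Here $\check{\mathrm{cl}}\,\mathbf B^n_t$ is the function whose components are the convex closures of the components of $\mathbf B^n_t$: componentwise, $$\check{\mathrm{cl}}\,\mathbf B^n_t(\tilde{\mathbf a}^n,\omega)=\inf\Big\{\sum_kp^k\mathbf B^n_t(\mathbf a^{n,k},\omega):\ \tilde{\mathbf a}^n=\sum_kp^k\mathbf a^{n,k},\ \mathbf a^{n,k}\in\mathcal A^n(T),\ \sum_kp^k=1,\ p^k\ge0\Big\},$$ all sums being finite. *)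

theory Defs
  imports "HOL-Probability.Probability"
begin

text \<open>
  Projects are indexed by a finite type \<open>'n\<close>, and the constraints by a finite type \<open>'l\<close>, so that
  \<open>CARD('l)\<close> is the number of linking constraints. The state spaces of all projects are realised
  inside one type \<open>'x\<close>, each with its own carrier and sigma-algebra, and the action sets inside one
  Euclidean space \<open>'a\<close> into which the action spaces of the individual projects embed linearly.

  \<open>traj W n as \<omega>\<close> is the state of project \<open>n\<close> at time \<open>length as\<close> in scenario \<open>\<omega>\<close> after the
  controls \<open>as = [a\<^sub>0, \<dots>]\<close> have been applied to this project; \<open>traj W n [] \<omega>\<close> is its initial state.
\<close>

record ('n, 'x, 'a, 'l, 'w) wcdp =
  states :: "'n \<Rightarrow> 'x measure"
  actions :: "'n \<Rightarrow> 'x \<Rightarrow> 'a set"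
  kernel :: "'n \<Rightarrow> 'x \<Rightarrow> 'a \<Rightarrow> 'x measure"
  reward :: "'n \<Rightarrow> 'x \<Rightarrow> 'a \<Rightarrow> real"
  cons :: "'n \<Rightarrow> 'x \<Rightarrow> 'a \<Rightarrow> real ^ 'l::finite"
  budget :: "real ^ 'l"
  discount :: real
  scenarios :: "'w measure"
  traj :: "'n \<Rightarrow> 'a list \<Rightarrow> 'w \<Rightarrow> 'x"

definition project_graph ::
    "('n::finite, 'x, 'a::euclidean_space, 'l::finite, 'w) wcdp \<Rightarrow> 'n \<Rightarrow> ('x \<times> 'a) set" where
  "project_graph W n = {(x, a). x \<in> space (states W n) \<and> a \<in> actions W n x}"

definition is_wcdp :: "('n::finite, 'x, 'a::euclidean_space, 'l::finite, 'w) wcdp \<Rightarrow> bool" where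
  "is_wcdp W \<longleftrightarrow>
     0 < discount W \<and> discount W < 1 \<and>
     (\<forall>n. (\<lambda>(x, a). kernel W n x a)
            \<in> measurable (restrict_space (states W n \<Otimes>\<^sub>M borel) (project_graph W n))
                         (prob_algebra (states W n))) \<and>
     (\<forall>n. \<exists>C. \<forall>(x, a) \<in> project_graph W n. \<bar>reward W n x a\<bar> \<le> C)"

definition joint_states ::
    "('n::finite, 'x, 'a::euclidean_space, 'l::finite, 'w) wcdp \<Rightarrow> ('n \<Rightarrow> 'x) measure" where
  "joint_states W = (\<Pi>\<^sub>M n\<in>UNIV. states W n)"

definition joint_actions ::
    "('n::finite, 'x, 'a::euclidean_space, 'l::finite, 'w) wcdp \<Rightarrow> ('n \<Rightarrow> 'x) \<Rightarrow> ('n \<Rightarrow> 'a) set" where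
  "joint_actions W x = {a. \<forall>n. a n \<in> actions W n (x n)}"

definition joint_reward ::
    "('n::finite, 'x, 'a::euclidean_space, 'l::finite, 'w) wcdp \<Rightarrow> ('n \<Rightarrow> 'x) \<Rightarrow> ('n \<Rightarrow> 'a) \<Rightarrow> real" where
  "joint_reward W x a = (\<Sum>n\<in>UNIV. reward W n (x n) (a n))"

definition joint_cons ::
    "('n::finite, 'x, 'a::euclidean_space, 'l::finite, 'w) wcdp \<Rightarrow>
      ('n \<Rightarrow> 'x) \<Rightarrow> ('n \<Rightarrow> 'a) \<Rightarrow> real ^ 'l" where
  "joint_cons W x a = (\<Sum>n\<in>UNIV. cons W n (x n) (a n))"

definition joint_kernel ::
    "('n::finite, 'x, 'a::euclidean_space, 'l::finite, 'w) wcdp \<Rightarrow>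
      ('n \<Rightarrow> 'x) \<Rightarrow> ('n \<Rightarrow> 'a) \<Rightarrow> ('n \<Rightarrow> 'x) measure" where
  "joint_kernel W x a = (\<Pi>\<^sub>M n\<in>UNIV. kernel W n (x n) (a n))"

text \<open>The order on \<open>real ^ 'l\<close> is the componentwise one.\<close>

definition feasible_actions ::
    "('n::finite, 'x, 'a::euclidean_space, 'l::finite, 'w) wcdp \<Rightarrow> ('n \<Rightarrow> 'x) \<Rightarrow> ('n \<Rightarrow> 'a) set" where
  "feasible_actions W x = {a \<in> joint_actions W x. joint_cons W x a \<le> budget W}"

text \<open>
  A control sequence \<open>(a\<^sub>0, \<dots>, a\<^sub>T)\<close> is a function on \<open>nat\<close> that vanishes after \<open>T\<close>. On such functions
  the product topology is the Euclidean topology of the first \<open>T + 1\<close> entries.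
\<close>

definition project_state ::
    "('n::finite, 'x, 'a::euclidean_space, 'l::finite, 'w) wcdp \<Rightarrow>
      'n \<Rightarrow> (nat \<Rightarrow> 'a) \<Rightarrow> 'w \<Rightarrow> nat \<Rightarrow> 'x" where
  "project_state W n a \<omega> t = traj W n (map a [0..<t]) \<omega>"

definition joint_state ::
    "('n::finite, 'x, 'a::euclidean_space, 'l::finite, 'w) wcdp \<Rightarrow>
      (nat \<Rightarrow> 'n \<Rightarrow> 'a) \<Rightarrow> 'w \<Rightarrow> nat \<Rightarrow> 'n \<Rightarrow> 'x" where
  "joint_state W a \<omega> t = (\<lambda>n. project_state W n (\<lambda>s. a s n) \<omega> t)"

definition initial_state ::
    "('n::finite, 'x, 'a::euclidean_space, 'l::finite, 'w) wcdp \<Rightarrow> 'w \<Rightarrow> 'n \<Rightarrow> 'x" where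
  "initial_state W \<omega> = (\<lambda>n. traj W n [] \<omega>)"

definition scenario_model :: "('n::finite, 'x, 'a::euclidean_space, 'l::finite, 'w) wcdp \<Rightarrow> bool" where
  "scenario_model W \<longleftrightarrow>
     prob_space (scenarios W) \<and>
     initial_state W \<in> measurable (scenarios W) (joint_states W) \<and>
     (\<forall>n. \<forall>\<omega> \<in> space (scenarios W). \<forall>as.
        (\<forall>t < length as. as ! t \<in> actions W n (traj W n (take t as) \<omega>)) \<longrightarrow>
        traj W n as \<omega> \<in> space (states W n))"

definition project_controls ::
    "('n::finite, 'x, 'a::euclidean_space, 'l::finite, 'w) wcdp \<Rightarrow>
      'n \<Rightarrow> 'w \<Rightarrow> nat \<Rightarrow> (nat \<Rightarrow> 'a) set" where
  "project_controls W n \<omega> T =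
     {a. (\<forall>t\<le>T. a t \<in> actions W n (project_state W n a \<omega> t)) \<and> (\<forall>t>T. a t = 0)}"

definition joint_controls ::
    "('n::finite, 'x, 'a::euclidean_space, 'l::finite, 'w) wcdp \<Rightarrow>
      'w \<Rightarrow> nat \<Rightarrow> (nat \<Rightarrow> 'n \<Rightarrow> 'a) set" where
  "joint_controls W \<omega> T =
     {a. (\<forall>t\<le>T. a t \<in> joint_actions W (joint_state W a \<omega> t)) \<and> (\<forall>t>T. \<forall>n. a t n = 0)}"

definition feasible_controls ::
    "('n::finite, 'x, 'a::euclidean_space, 'l::finite, 'w) wcdp \<Rightarrow>
      'w \<Rightarrow> nat \<Rightarrow> (nat \<Rightarrow> 'n \<Rightarrow> 'a) set" where
  "feasible_controls W \<omega> T =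
     {a. (\<forall>t\<le>T. a t \<in> feasible_actions W (joint_state W a \<omega> t)) \<and> (\<forall>t>T. \<forall>n. a t n = 0)}"

definition project_drift ::
    "('n::finite, 'x, 'a::euclidean_space, 'l::finite, 'w) wcdp \<Rightarrow>
      ('n \<Rightarrow> 'x \<Rightarrow> real) \<Rightarrow> 'n \<Rightarrow> 'x \<Rightarrow> 'a \<Rightarrow> real" where
  "project_drift W h n x a =
     reward W n x a + discount W * (\<integral>y. h n y \<partial>kernel W n x a) - h n x"

definition project_cons_at ::
    "('n::finite, 'x, 'a::euclidean_space, 'l::finite, 'w) wcdp \<Rightarrow>
      'n \<Rightarrow> 'w \<Rightarrow> nat \<Rightarrow> (nat \<Rightarrow> 'a) \<Rightarrow> real ^ 'l" where
  "project_cons_at W n \<omega> t a = cons W n (project_state W n a \<omega> t) (a t)"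

definition project_I ::
    "('n::finite, 'x, 'a::euclidean_space, 'l::finite, 'w) wcdp \<Rightarrow>
      ('n \<Rightarrow> 'x \<Rightarrow> real) \<Rightarrow> 'n \<Rightarrow> (nat \<Rightarrow> 'a) \<Rightarrow> 'w \<Rightarrow> nat \<Rightarrow> real" where
  "project_I W h n a \<omega> T = (\<Sum>t=0..T. project_drift W h n (project_state W n a \<omega> t) (a t))"

definition joint_I ::
    "('n::finite, 'x, 'a::euclidean_space, 'l::finite, 'w) wcdp \<Rightarrow>
      (('n \<Rightarrow> 'x) \<Rightarrow> real) \<Rightarrow> (nat \<Rightarrow> 'n \<Rightarrow> 'a) \<Rightarrow> 'w \<Rightarrow> nat \<Rightarrow> (nat \<Rightarrow> real ^ 'l) \<Rightarrow> real" where
  "joint_I W H a \<omega> T \<mu> =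
     (\<Sum>t=0..T.
        let x = joint_state W a \<omega> t in
          joint_reward W x (a t) + discount W * (\<integral>y. H y \<partial>joint_kernel W x (a t)) - H x
          + \<mu> t \<bullet> (budget W - joint_cons W x (a t)))"

definition multipliers :: "nat \<Rightarrow> (nat \<Rightarrow> real ^ 'l::finite) set" where
  "multipliers T = {\<mu>. (\<forall>t\<le>T. 0 \<le> \<mu> t) \<and> (\<forall>t>T. \<mu> t = 0)}"

definition exact_inner ::
    "('n::finite, 'x, 'a::euclidean_space, 'l::finite, 'w) wcdp \<Rightarrow>
      (('n \<Rightarrow> 'x) \<Rightarrow> real) \<Rightarrow> 'w \<Rightarrow> nat \<Rightarrow> real" where
  "exact_inner W H \<omega> T = (SUP a \<in> feasible_controls W \<omega> T. joint_I W H a \<omega> T (\<lambda>_. 0))"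

definition practical_inner ::
    "('n::finite, 'x, 'a::euclidean_space, 'l::finite, 'w) wcdp \<Rightarrow>
      (('n \<Rightarrow> 'x) \<Rightarrow> real) \<Rightarrow> 'w \<Rightarrow> nat \<Rightarrow> real" where
  "practical_inner W H \<omega> T =
     (INF \<mu> \<in> multipliers T. SUP a \<in> joint_controls W \<omega> T. joint_I W H a \<omega> T \<mu>)"

text \<open>
  \<open>\<kappa> x\<close> is a version of the conditional law of the scenario given that the initial state is \<open>x\<close>;
  the integral against it is the expectation given \<open>x\<^sub>0 = x\<close>, defined at every \<open>x\<close>.
\<close>

definition scenario_law_given_initial ::
    "('n::finite, 'x, 'a::euclidean_space, 'l::finite, 'w) wcdp \<Rightarrow>
      (('n \<Rightarrow> 'x) \<Rightarrow> 'w measure) \<Rightarrow> bool" where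
  "scenario_law_given_initial W \<kappa> \<longleftrightarrow>
     \<kappa> \<in> measurable (joint_states W) (prob_algebra (scenarios W)) \<and>
     (\<forall>E \<in> sets (scenarios W).
        AE \<omega> in scenarios W.
          measure (\<kappa> (initial_state W \<omega>)) E =
          real_cond_exp (scenarios W)
            (vimage_algebra (space (scenarios W)) (initial_state W) (joint_states W))
            (indicator E) \<omega>)"

text \<open>
  \<open>geometric_pmf (1 - \<beta>)\<close> assigns the mass \<open>(1 - \<beta>) * \<beta> ^ t\<close> to \<open>t\<close>. Since \<open>\<tau>\<close> is independent of the
  scenario, the joint law of both given the initial state is a product measure.
\<close>

definition scenario_time_law ::
    "('n::finite, 'x, 'a::euclidean_space, 'l::finite, 'w) wcdp \<Rightarrow>
      (('n \<Rightarrow> 'x) \<Rightarrow> 'w measure) \<Rightarrow> ('n \<Rightarrow> 'x) \<Rightarrow> ('w \<times> nat) measure" where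
  "scenario_time_law W \<kappa> x = \<kappa> x \<Otimes>\<^sub>M measure_pmf (geometric_pmf (1 - discount W))"

definition exact_bound ::
    "('n::finite, 'x, 'a::euclidean_space, 'l::finite, 'w) wcdp \<Rightarrow>
      (('n \<Rightarrow> 'x) \<Rightarrow> 'w measure) \<Rightarrow> (('n \<Rightarrow> 'x) \<Rightarrow> real) \<Rightarrow> ('n \<Rightarrow> 'x) \<Rightarrow> real" where
  "exact_bound W \<kappa> H x = H x + (\<integral>(\<omega>, \<tau>). exact_inner W H \<omega> \<tau> \<partial>scenario_time_law W \<kappa> x)"

definition practical_bound ::
    "('n::finite, 'x, 'a::euclidean_space, 'l::finite, 'w) wcdp \<Rightarrow>
      (('n \<Rightarrow> 'x) \<Rightarrow> 'w measure) \<Rightarrow> (('n \<Rightarrow> 'x) \<Rightarrow> real) \<Rightarrow> ('n \<Rightarrow> 'x) \<Rightarrow> real" where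
  "practical_bound W \<kappa> H x = H x + (\<integral>(\<omega>, \<tau>). practical_inner W H \<omega> \<tau> \<partial>scenario_time_law W \<kappa> x)"

definition project_gap ::
    "('n::finite, 'x, 'a::euclidean_space, 'l::finite, 'w) wcdp \<Rightarrow> ('n \<Rightarrow> 'x \<Rightarrow> real) \<Rightarrow> 'n \<Rightarrow> real" where
  "project_gap W h n =
     (SUP (x, a) \<in> project_graph W n. project_drift W h n x a)
     - (INF (x, a) \<in> project_graph W n. project_drift W h n x a)"

definition convex_weights :: "nat \<Rightarrow> (nat \<Rightarrow> real) \<Rightarrow> bool" where
  "convex_weights m p \<longleftrightarrow> (\<forall>k<m. 0 \<le> p k) \<and> (\<Sum>k<m. p k) = 1"

text \<open>
  The library's convex hull needs a real vector space type, which \<open>nat \<Rightarrow> 'a\<close> is not; convex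
  combinations of control sequences are taken entrywise.
\<close>

definition seq_conv :: "(nat \<Rightarrow> 'a::real_vector) set \<Rightarrow> (nat \<Rightarrow> 'a) set" where
  "seq_conv S =
     {(\<lambda>t. \<Sum>k<m. p k *\<^sub>R a k t) | m p a. convex_weights m p \<and> (\<forall>k<m. a k \<in> S)}"

definition convex_closure ::
    "(nat \<Rightarrow> 'a::real_vector) set \<Rightarrow> ((nat \<Rightarrow> 'a) \<Rightarrow> real) \<Rightarrow> (nat \<Rightarrow> 'a) \<Rightarrow> real" where
  "convex_closure S f y =
     Inf {(\<Sum>k<m. p k * f (a k)) | m p a.
            convex_weights m p \<and> (\<forall>k<m. a k \<in> S) \<and> y = (\<lambda>t. \<Sum>k<m. p k *\<^sub>R a k t)}"

definition assumption1 :: "('n::finite, 'x, 'a::euclidean_space, 'l::finite, 'w) wcdp \<Rightarrow> bool" where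
  "assumption1 W \<longleftrightarrow> (\<forall>x \<in> space (joint_states W). feasible_actions W x \<noteq> {})"

definition outcome_set ::
    "('n::finite, 'x, 'a::euclidean_space, 'l::finite, 'w) wcdp \<Rightarrow> ('n \<Rightarrow> 'x \<Rightarrow> real) \<Rightarrow>
      'n \<Rightarrow> 'w \<Rightarrow> nat \<Rightarrow> ((nat \<Rightarrow> 'a) \<times> (nat \<Rightarrow> real ^ 'l) \<times> real) set" where
  "outcome_set W h n \<omega> T =
     (\<lambda>a. (a, (\<lambda>t. if t \<le> T then project_cons_at W n \<omega> t a else 0), project_I W h n a \<omega> T))
       ` project_controls W n \<omega> T"

definition assumption2 ::
    "('n::finite, 'x, 'a::euclidean_space, 'l::finite, 'w) wcdp \<Rightarrow>
      ('n \<Rightarrow> 'x \<Rightarrow> real) \<Rightarrow> 'w \<Rightarrow> nat \<Rightarrow> bool" where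
  "assumption2 W h \<omega> T \<longleftrightarrow>
     (\<forall>n. outcome_set W h n \<omega> T \<noteq> {} \<and> compact (outcome_set W h n \<omega> T))"

text \<open>The infimum in the convex closure is finite wherever it is used when \<open>assumption2\<close> holds.\<close>

definition assumption3 ::
    "('n::finite, 'x, 'a::euclidean_space, 'l::finite, 'w) wcdp \<Rightarrow> 'w \<Rightarrow> nat \<Rightarrow> bool" where
  "assumption3 W \<omega> T \<longleftrightarrow>
     (\<forall>n. \<forall>y \<in> seq_conv (project_controls W n \<omega> T).
        \<exists>a \<in> project_controls W n \<omega> T. \<forall>t\<le>T. \<forall>i.
          project_cons_at W n \<omega> t a $ i
            \<le> convex_closure (project_controls W n \<omega> T) (\<lambda>a'. project_cons_at W n \<omega> t a' $ i) y)"

end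

theory Submission
  imports Defs
begin

text \<open>
  Fix a scenario and a horizon \<open>T\<close>. Since \<open>H\<close> is additively separable and the joint law is a product, the
  penalised reward \<open>I\<^sub>H\<close> is, up to a constant, the sum over the projects of terms depending only on
  the controls of one project. The exact inner problem thus maximises a separable function under
  \<open>m = L * (T + 1)\<close> linking constraints, one for each period and each of the \<open>L\<close> constraints, and the
  practical inner problem is its Lagrangian dual. The theorem is the Shapley--Folkman estimate of
  the duality gap of such a problem, averaged over \<open>\<tau>\<close>.

  The Lagrangian dual does not distinguish the problem from its convexification, in which every
  project may mix its control sequences. By the Shapley--Folkman theorem
  (\<open>Shapley_Folkman_weights\<close>), a mixture can be rearranged, with the same consumption of the \<open>m\<close>
  resources and the same reward, so that at most \<open>m + 1\<close> projects really mix. The convexity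
  assumption replaces the mixture of such a project by a single control sequence that consumes no
  more; its reward drops by at most the oscillation of the reward of one project over \<open>T + 1\<close>
  periods, which is at most \<open>(T + 1) * \<Gamma>\<close> with \<open>\<Gamma>\<close> the largest of the \<open>\<Gamma>\<^sup>n\<close> (\<open>rounding\<close>). Hence the gap is
  at most \<open>(m + 1) * (T + 1) * \<Gamma>\<close>.

  The multipliers come from a separation argument in \<open>m + 1\<close> dimensions
  (\<open>Lagrange_multipliers_duality_gap\<close>): one nearly minimises the squared distance from the convexified
  outcomes to the target set of outcomes that respect the budgets and earn slightly more than
  the exact value plus the gap. Rounding and the compactness of the outcome sets keep this
  distance away from \<open>0\<close>, and the feasibility of the exact problem keeps the separating
  hyperplane from being vertical.

  Finally, \<open>\<tau>\<close> is geometric with \<open>E (\<tau> + 1) = 1 / (1 - \<beta>)\<close> and \<open>E (\<tau> + 1)\<^sup>2 = (1 + \<beta>) / (1 - \<beta>)\<^sup>2\<close>, so the average of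
  \<open>(L * (\<tau> + 1) + 1) * (\<tau> + 1) * \<Gamma>\<close> is
  \<open>(L * (1 + \<beta>) + 1 - \<beta>) / (1 - \<beta>)\<^sup>2 * \<Gamma> = ((L - 1) * \<beta> + L + 1) / (1 - \<beta>)\<^sup>2 * \<Gamma>\<close>.
\<close>

section \<open>The Shapley--Folkman theorem\<close>

text \<open>
  A homogeneous system with fewer equations (indexed by \<open>F\<close>) than unknowns (indexed by \<open>K\<close>),
  treated by Gaussian elimination. Index sets are used instead of a vector space of fixed
  dimension because the number of equations will depend on the horizon.
\<close>

lemma homogeneous_system_nontrivial_solution:
  fixes f :: "'f \<Rightarrow> 'k \<Rightarrow> 'r::field"
  assumes "finite F" "finite K" "card F < card K"
  shows "\<exists>c. (\<exists>k\<in>K. c k \<noteq> 0) \<and> (\<forall>j\<in>F. (\<Sum>k\<in>K. c k * f j k) = 0)"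
  using assms
proof (induction F arbitrary: K f rule: finite_induct)
  case empty
  then have "K \<noteq> {}" by auto
  then show ?case by (intro exI[of _ "\<lambda>_. 1"]) auto
next
  case (insert i F)
  show ?case
  proof (cases "\<forall>k\<in>K. f i k = 0")
    case True
    moreover obtain c where "\<exists>k\<in>K. c k \<noteq> 0" "\<forall>j\<in>F. (\<Sum>k\<in>K. c k * f j k) = 0"
      using insert by (metis Suc_lessD card_insert_disjoint)
    ultimately show ?thesis by auto
  next
    case False
    then obtain p where p: "p \<in> K" "f i p \<noteq> 0" by blast
    \<comment> \<open>Equation \<open>i\<close> is solved for the unknown \<open>p\<close>, which is then eliminated from the others.\<close>
    define g where "g j k = f j k - f i k / f i p * f j p" for j k
    have "card F < card (K - {p})"
      using insert p by (simp add: card_Diff_singleton)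
    with insert.prems obtain c where
      c: "\<exists>k\<in>K - {p}. c k \<noteq> 0" "\<forall>j\<in>F. (\<Sum>k\<in>K - {p}. c k * g j k) = 0"
      using insert.IH[of "K - {p}" g] by auto
    define s where "s = (\<Sum>k\<in>K - {p}. c k * f i k)"
    define c' where "c' = c(p := - s / f i p)"
    have split: "(\<Sum>k\<in>K. c' k * f j k) = - s / f i p * f j p + (\<Sum>k\<in>K - {p}. c k * f j k)" for j
    proof -
      have "(\<Sum>k\<in>K. c' k * f j k) = c' p * f j p + (\<Sum>k\<in>K - {p}. c' k * f j k)"
        using p insert.prems by (simp add: sum.remove)
      also have "(\<Sum>k\<in>K - {p}. c' k * f j k) = (\<Sum>k\<in>K - {p}. c k * f j k)"
        by (intro sum.cong) (auto simp: c'_def)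
      finally show ?thesis by (simp add: c'_def)
    qed
    have "(\<Sum>k\<in>K. c' k * f j k) = 0" if "j \<in> insert i F" for j
    proof (cases "j = i")
      case True
      then show ?thesis using p split[of i] by (simp add: s_def)
    next
      case False
      have "(\<Sum>k\<in>K - {p}. c k * g j k) = (\<Sum>k\<in>K - {p}. c k * f j k) - s / f i p * f j p"
        by (simp add: g_def s_def right_diff_distrib sum_subtractf sum_distrib_right
            sum_divide_distrib mult.assoc)
      then show ?thesis using split[of j] c(2) that False by simp
    qed
    moreover have "\<exists>k\<in>K. c' k \<noteq> 0" using c(1) by (auto simp: c'_def)
    ultimately show ?thesis by blast
  qed
qed

text \<open>
  The Shapley--Folkman theorem in terms of weights. The matrix \<open>q\<close> describes one convex
  combination for each \<open>n\<close>, and each \<open>f j\<close> is a linear functional of the whole matrix. A feasible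
  matrix with the least number of nonzero entries is a basic solution of the linear system formed
  by the \<open>CARD('n)\<close> normalisations and the \<open>card F\<close> functionals, so it has at most
  \<open>CARD('n) + card F\<close> nonzero entries. Every row uses at least one of them, and a row that is not
  a unit vector at least two; this leaves at most \<open>card F\<close> rows that genuinely mix.
\<close>

lemma Shapley_Folkman_weights:
  fixes q :: "'n::finite \<Rightarrow> 'k \<Rightarrow> real" and f :: "'f \<Rightarrow> 'n \<Rightarrow> 'k \<Rightarrow> real"
  assumes "finite K" "finite F"
    and "\<And>n k. k \<in> K \<Longrightarrow> 0 \<le> q n k" "\<And>n. (\<Sum>k\<in>K. q n k) = 1"
  shows "\<exists>q'. (\<forall>n. \<forall>k\<in>K. 0 \<le> q' n k) \<and> (\<forall>n. (\<Sum>k\<in>K. q' n k) = 1) \<and>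
    (\<forall>j\<in>F. (\<Sum>n\<in>UNIV. \<Sum>k\<in>K. q' n k * f j n k) = (\<Sum>n\<in>UNIV. \<Sum>k\<in>K. q n k * f j n k)) \<and>
    card {n. \<forall>k\<in>K. q' n k \<noteq> 1} \<le> card F"
proof -
  define P where "P q' \<longleftrightarrow> (\<forall>n. \<forall>k\<in>K. 0 \<le> q' n k) \<and> (\<forall>n. (\<Sum>k\<in>K. q' n k) = 1) \<and>
    (\<forall>j\<in>F. (\<Sum>n\<in>UNIV. \<Sum>k\<in>K. q' n k * f j n k) = (\<Sum>n\<in>UNIV. \<Sum>k\<in>K. q n k * f j n k))"
    for q' :: "'n \<Rightarrow> 'k \<Rightarrow> real"
  define supp where "supp q' = {(n, k). k \<in> K \<and> q' n k \<noteq> 0}" for q' :: "'n \<Rightarrow> 'k \<Rightarrow> real"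
  have fin: "finite (supp q')" for q'
    by (rule finite_subset[of _ "UNIV \<times> K"]) (use assms(1) in \<open>auto simp: supp_def\<close>)
  have "P q" using assms by (simp add: P_def)
  then obtain q' where q': "P q'" and least: "\<And>r. P r \<Longrightarrow> card (supp q') \<le> card (supp r)"
    using ex_has_least_nat[of P q "\<lambda>r. card (supp r)"] by blast
  have nonneg: "0 \<le> q' n k" if "k \<in> K" for n k using q' that by (auto simp: P_def)
  have one: "(\<Sum>k\<in>K. q' n k) = 1" for n using q' by (auto simp: P_def)
  have small: "card (supp q') \<le> CARD('n) + card F"
  proof (rule ccontr)
    assume "\<not> ?thesis"
    then have big: "card (range Inl \<union> Inr ` F :: ('n + 'f) set) < card (supp q')"
      using assms(2) by (subst card_Un_disjoint) (auto simp: card_image)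
    let ?A = "\<lambda>j (n, k). case j of Inl n' \<Rightarrow> if n = n' then 1 else 0 | Inr i \<Rightarrow> f i n k"
    have "finite (range Inl \<union> Inr ` F :: ('n + 'f) set)" using assms(2) by simp
    from homogeneous_system_nontrivial_solution[OF this fin big, of ?A]
    obtain c0 :: "'n \<times> 'k \<Rightarrow> real" where c0: "\<exists>z\<in>supp q'. c0 z \<noteq> 0"
      "\<forall>j\<in>range Inl \<union> Inr ` F. (\<Sum>z\<in>supp q'. c0 z * ?A j z) = 0"
      by (elim exE conjE)
    define c where "c n k = (if (n, k) \<in> supp q' then c0 (n, k) else 0)" for n k
    have sum_c: "(\<Sum>n\<in>UNIV. \<Sum>k\<in>K. c n k * u (n, k)) = (\<Sum>z\<in>supp q'. c0 z * u z)" for u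
    proof -
      have "(\<Sum>n\<in>UNIV. \<Sum>k\<in>K. c n k * u (n, k)) = (\<Sum>z\<in>UNIV \<times> K. c (fst z) (snd z) * u z)"
        by (simp add: sum.cartesian_product split_beta)
      also have "\<dots> = (\<Sum>z\<in>supp q'. c (fst z) (snd z) * u z)"
        using assms(1) by (intro sum.mono_neutral_right) (auto simp: supp_def c_def)
      finally show ?thesis by (simp add: c_def)
    qed
    have c_row: "(\<Sum>k\<in>K. c n k) = 0" for n
    proof -
      have "(\<Sum>k\<in>K. c n k) = (\<Sum>n'\<in>UNIV. if n' = n then (\<Sum>k\<in>K. c n' k) else 0)" by simp
      also have "\<dots> = (\<Sum>n'\<in>UNIV. \<Sum>k\<in>K. c n' k * ?A (Inl n) (n', k))"
        by (intro sum.cong) auto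
      also have "\<dots> = 0"
        unfolding sum_c[of "?A (Inl n)"] by (rule c0(2)[rule_format]) simp
      finally show ?thesis .
    qed
    have c_f: "(\<Sum>n\<in>UNIV. \<Sum>k\<in>K. c n k * f j n k) = 0" if "j \<in> F" for j
      using c0(2)[rule_format, of "Inr j"] that sum_c[of "?A (Inr j)"] by simp
    obtain n1 k1 where nk1: "(n1, k1) \<in> supp q'" "c n1 k1 \<noteq> 0"
      using c0(1) by (auto simp: c_def)
    have "\<exists>k\<in>K. c n1 k < 0"
    proof (rule ccontr)
      assume "\<not> ?thesis"
      then have "\<forall>k\<in>K. c n1 k = 0"
        using c_row[of n1] sum_nonneg_eq_0_iff[OF assms(1), of "c n1"] by (auto simp: not_less)
      then show False using nk1 by (auto simp: supp_def)
    qed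
    then have ne: "{z \<in> supp q'. c (fst z) (snd z) < 0} \<noteq> {}" (is "?N \<noteq> {}")
      by (force simp: c_def split: if_splits)
    \<comment> \<open>The longest step along \<open>c\<close> that keeps all weights nonnegative annihilates one of them.\<close>
    define s where "s = Min ((\<lambda>z. q' (fst z) (snd z) / - c (fst z) (snd z)) ` ?N)"
    have s_le: "s \<le> q' n k / - c n k" if "(n, k) \<in> supp q'" "c n k < 0" for n k
      unfolding s_def using that fin by (intro Min_le) force+
    have "s \<in> (\<lambda>z. q' (fst z) (snd z) / - c (fst z) (snd z)) ` ?N"
      unfolding s_def using ne fin by (intro Min_in) auto
    then obtain n2 k2 where nk2: "(n2, k2) \<in> supp q'" "c n2 k2 < 0" "s = q' n2 k2 / - c n2 k2"
      by auto
    have s0: "0 \<le> s"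
      using nk2 nonneg[of k2 n2] by (auto simp: supp_def divide_nonneg_neg)
    define r where "r n k = q' n k + s * c n k" for n k
    have "0 \<le> r n k" if "k \<in> K" for n k
    proof (cases "c n k < 0")
      case True
      then have "(n, k) \<in> supp q'" by (auto simp: c_def split: if_splits)
      from s_le[OF this True] True show ?thesis
        by (simp add: r_def field_simps)
    next
      case False
      then show ?thesis using s0 nonneg[OF that] by (simp add: r_def)
    qed
    moreover have "(\<Sum>k\<in>K. r n k) = 1" for n
      using one[of n] c_row[of n] by (simp add: r_def sum.distrib flip: sum_distrib_left)
    moreover have "(\<Sum>n\<in>UNIV. \<Sum>k\<in>K. r n k * f j n k) = (\<Sum>n\<in>UNIV. \<Sum>k\<in>K. q' n k * f j n k)"
      if "j \<in> F" for j
      using c_f[OF that]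
      by (simp add: r_def distrib_right sum.distrib mult.assoc flip: sum_distrib_left)
    ultimately have "P r" using q' by (auto simp: P_def)
    moreover have "supp r \<subset> supp q'"
    proof -
      have "supp r \<subseteq> supp q'" by (auto simp: supp_def r_def c_def)
      moreover have "(n2, k2) \<notin> supp r" using nk2 by (simp add: supp_def r_def)
      ultimately show ?thesis using nk2 by blast
    qed
    ultimately show False using least[of r] psubset_card_mono[OF fin, of "supp r" q'] by simp
  qed
  let ?row = "\<lambda>n. {k \<in> K. q' n k \<noteq> 0}"
  let ?B = "{n. \<forall>k\<in>K. q' n k \<noteq> 1}"
  have row: "1 + (if n \<in> ?B then 1 else 0) \<le> card (?row n)" for n
  proof -
    have sum_row: "(\<Sum>k\<in>?row n. q' n k) = 1"
      using one[of n] assms(1) by (subst (asm) sum.mono_neutral_right[of K "?row n"]) auto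
    have "?row n \<noteq> {}"
    proof
      assume "?row n = {}"
      with sum_row show False by (simp only: sum.empty)
    qed
    then have pos: "card (?row n) \<noteq> 0" using assms(1) by simp
    have unmixed: "n \<notin> ?B" if single: "card (?row n) = 1"
    proof -
      obtain k where k: "?row n = {k}" using single by (rule card_1_singletonE)
      have "k \<in> K" using k by blast
      moreover have "q' n k = 1" using sum_row unfolding k by simp
      ultimately show ?thesis by blast
    qed
    show ?thesis
    proof (cases "n \<in> ?B")
      case True
      then have "card (?row n) \<noteq> 1" using unmixed by blast
      then show ?thesis using pos by (simp only: True if_True)
    next
      case False
      then show ?thesis using pos by (simp only: False if_False)
    qed
  qed
  have "CARD('n) + card ?B = (\<Sum>n\<in>UNIV. 1 + (if n \<in> ?B then 1 else 0))"
    by (simp only: sum.distrib sum.If_cases[OF finite]) simp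
  also have "\<dots> \<le> (\<Sum>n\<in>UNIV. card (?row n))" by (intro sum_mono row)
  also have "\<dots> = card (SIGMA n:UNIV. ?row n)" using assms(1) by (subst card_SigmaI) auto
  also have "(SIGMA n:UNIV. ?row n) = supp q'" by (auto simp: supp_def)
  finally have "card ?B \<le> card F" using small by simp
  with q' show ?thesis unfolding P_def by (intro exI[of _ q'] conjI) (elim conjE, assumption)+
qed

section \<open>The duality gap of separable programs\<close>

lemma compact_Pi_UNIV:
  fixes S :: "'n \<Rightarrow> 'b::topological_space set"
  assumes "\<And>n. compact (S n)"
  shows "compact (Pi UNIV S)"
proof -
  have "compactin (product_topology (\<lambda>n. euclidean) UNIV) (PiE UNIV S)"
    using assms by (simp add: compactin_PiE)
  then show ?thesis
    unfolding euclidean_product_topology by (simp add: PiE_def)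
qed

lemma power2_max_0_add_le:
  fixes x d :: real
  shows "(max 0 (x + d))\<^sup>2 \<le> (max 0 x)\<^sup>2 + 2 * (max 0 x * d) + d\<^sup>2"
proof -
  have "\<bar>max 0 (x + d)\<bar> \<le> \<bar>max 0 x + d\<bar>" by linarith
  then have "(max 0 (x + d))\<^sup>2 \<le> (max 0 x + d)\<^sup>2" by (simp only: abs_le_square_iff)
  also have "\<dots> = (max 0 x)\<^sup>2 + 2 * (max 0 x * d) + d\<^sup>2" by (simp add: power2_sum)
  finally show ?thesis .
qed

text \<open>
  A resource allocation problem: agent \<open>n\<close> chooses \<open>x n \<in> A n\<close>, consuming \<open>g n (x n) j\<close> of the
  resource \<open>j\<close>, whose supply is \<open>b j\<close>, and earning \<open>r n (x n)\<close>. The condition \<open>convex_like\<close> says that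
  randomisation does not help an agent to save resources, although it may help to increase the
  reward; \<open>D\<close> bounds what the reward can lose when a mixture is replaced by a single choice.
\<close>

locale separable_program =
  fixes A :: "'n::finite \<Rightarrow> 'c set"
    and g :: "'n \<Rightarrow> 'c \<Rightarrow> 'j \<Rightarrow> real"
    and r :: "'n \<Rightarrow> 'c \<Rightarrow> real"
    and b :: "'j \<Rightarrow> real"
    and J :: "'j set"
    and D :: real
  assumes finite_J: "finite J"
    and compact_outcomes: "\<And>n. compact ((\<lambda>x. (g n x, r n x)) ` A n)"
    and convex_like: "\<And>n m p x. convex_weights m p \<Longrightarrow> \<forall>k<m. x k \<in> A n \<Longrightarrow>
      \<exists>y\<in>A n. \<forall>j\<in>J. g n y j \<le> (\<Sum>k<m. p k * g n (x k) j)"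
    and oscillation: "\<And>n x y. x \<in> A n \<Longrightarrow> y \<in> A n \<Longrightarrow> r n x - r n y \<le> D"
    and feasible: "\<exists>x\<in>Pi UNIV A. \<forall>j\<in>J. (\<Sum>n\<in>UNIV. g n (x n) j) \<le> b j"
begin

definition usage :: "('n \<Rightarrow> 'c) \<Rightarrow> 'j \<Rightarrow> real" where
  "usage x j = (\<Sum>n\<in>UNIV. g n (x n) j)"

definition gain :: "('n \<Rightarrow> 'c) \<Rightarrow> real" where
  "gain x = (\<Sum>n\<in>UNIV. r n (x n))"

text \<open>
  The convex hull of the attainable pairs of total consumption and total reward.
\<close>

definition mixtures :: "(('j \<Rightarrow> real) \<times> real) set" where
  "mixtures = {((\<lambda>j. \<Sum>k<m. p k * usage (x k) j), (\<Sum>k<m. p k * gain (x k))) | m p x.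
     convex_weights m p \<and> (\<forall>k<m. x k \<in> Pi UNIV A)}"

text \<open>
  The squared distance from \<open>(u, w)\<close> to the quadrant of pairs that respect the supplies and earn
  at least \<open>v\<close>.
\<close>

definition excess :: "real \<Rightarrow> ('j \<Rightarrow> real) \<Rightarrow> real \<Rightarrow> real" where
  "excess v u w = (\<Sum>j\<in>J. (max 0 (u j - b j))\<^sup>2) + (max 0 (v - w))\<^sup>2"

lemma oscillation_nonneg: "0 \<le> D"
proof -
  obtain x where "x \<in> Pi UNIV A" using feasible by blast
  then have "x undefined \<in> A undefined" by auto
  from oscillation[OF this this] show ?thesis by simp
qed

text \<open>
  A point of the hull is a mixture of the choices of each single agent. By Shapley--Folkman,
  applied to the consumptions of the \<open>card J\<close> resources and the reward, all but \<open>card J + 1\<close> agents may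
  be assumed not to mix. Each of the remaining ones is moved to a single choice by
  \<open>convex_like\<close>: this does not increase any consumption and costs at most \<open>D\<close>.
\<close>

lemma rounding:
  assumes p: "convex_weights m p" and x: "\<forall>k<m. x k \<in> Pi UNIV A"
  obtains y where "y \<in> Pi UNIV A"
    and "\<forall>j\<in>J. usage y j \<le> (\<Sum>k<m. p k * usage (x k) j)"
    and "(\<Sum>k<m. p k * gain (x k)) - (real (card J) + 1) * D \<le> gain y"
proof -
  define F where "F = insert None (Some ` J)"
  define f where "f i n k = (case i of None \<Rightarrow> r n (x k n) | Some j \<Rightarrow> g n (x k n) j)" for i n k
  have card_F: "card F = card J + 1" and fin_F: "finite F"
    using finite_J by (auto simp: F_def card_image card_insert_if)
  have xA: "x k n \<in> A n" if "k < m" for k n using x that by auto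
  have p0: "\<And>k. k \<in> {..<m} \<Longrightarrow> 0 \<le> p k" and p1: "(\<Sum>k<m. p k) = 1"
    using p by (auto simp: convex_weights_def)
  obtain q where weights: "(\<forall>n. \<forall>k\<in>{..<m}. 0 \<le> q n k) \<and> (\<forall>n. (\<Sum>k<m. q n k) = 1) \<and>
      (\<forall>i\<in>F. (\<Sum>n\<in>UNIV. \<Sum>k<m. q n k * f i n k) = (\<Sum>n\<in>UNIV. \<Sum>k<m. p k * f i n k)) \<and>
      card {n. \<forall>k\<in>{..<m}. q n k \<noteq> 1} \<le> card F"
    using Shapley_Folkman_weights[of "{..<m}" F "\<lambda>_. p" f, OF finite_lessThan fin_F p0 p1] ..
  then have q: "\<And>n k. k \<in> {..<m} \<Longrightarrow> 0 \<le> q n k" "\<And>n. (\<Sum>k<m. q n k) = 1"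
    and q_eq: "\<And>i. i \<in> F \<Longrightarrow> (\<Sum>n\<in>UNIV. \<Sum>k<m. q n k * f i n k) = (\<Sum>n\<in>UNIV. \<Sum>k<m. p k * f i n k)"
    and few: "card {n. \<forall>k\<in>{..<m}. q n k \<noteq> 1} \<le> card F"
    by blast+
  let ?mixed = "{n. \<forall>k\<in>{..<m}. q n k \<noteq> 1}"
  define good where "good n y \<longleftrightarrow> y \<in> A n \<and> (\<forall>j\<in>J. g n y j \<le> (\<Sum>k<m. q n k * g n (x k n) j)) \<and>
    (\<Sum>k<m. q n k * r n (x k n)) - (if n \<in> ?mixed then D else 0) \<le> r n y" for n y
  have "\<exists>y. good n y" for n
  proof (cases "n \<in> ?mixed")
    case True
    have cw: "convex_weights m (q n)" using q by (simp add: convex_weights_def)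
    obtain y where y: "y \<in> A n" "\<forall>j\<in>J. g n y j \<le> (\<Sum>k<m. q n k * g n (x k n) j)"
      using convex_like[OF cw, of "\<lambda>k. x k n"] xA by blast
    have "(\<Sum>k<m. q n k * r n (x k n)) \<le> (\<Sum>k<m. q n k * (r n y + D))"
      using oscillation[OF xA y(1)] q(1) by (intro sum_mono mult_left_mono) (auto simp: diff_le_eq add.commute)
    also have "\<dots> = r n y + D" using q(2)[of n] by (simp flip: sum_distrib_right)
    finally have "good n y" using True y by (simp add: good_def)
    then show ?thesis ..
  next
    case False
    then obtain k where k: "k < m" "q n k = 1" by auto
    have "(\<Sum>i\<in>{..<m} - {k}. q n i) = 0"
      using q(2)[of n] k by (simp add: sum.remove[of "{..<m}" k])
    then have zero: "q n i = 0" if "i < m" "i \<noteq> k" for i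
      using q(1)[of _ n] that by (subst (asm) sum_nonneg_eq_0_iff) auto
    have "(\<Sum>i<m. q n i * u i) = u k" for u
    proof -
      have "(\<Sum>i<m. q n i * u i) = q n k * u k + (\<Sum>i\<in>{..<m} - {k}. q n i * u i)"
        using k by (simp add: sum.remove)
      also have "(\<Sum>i\<in>{..<m} - {k}. q n i * u i) = 0" using zero by (intro sum.neutral) auto
      finally show ?thesis using k by simp
    qed
    then have "good n (x k n)" using False xA[OF k(1)] by (simp add: good_def oscillation_nonneg)
    then show ?thesis ..
  qed
  then obtain y where "\<And>n. good n (y n)" by metis
  then have y: "\<And>n. y n \<in> A n"
    "\<And>n j. j \<in> J \<Longrightarrow> g n (y n) j \<le> (\<Sum>k<m. q n k * g n (x k n) j)"
    "\<And>n. (\<Sum>k<m. q n k * r n (x k n)) - (if n \<in> ?mixed then D else 0) \<le> r n (y n)"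
    unfolding good_def by blast+
  have "usage y j \<le> (\<Sum>k<m. p k * usage (x k) j)" if "j \<in> J" for j
  proof -
    have "usage y j \<le> (\<Sum>n\<in>UNIV. \<Sum>k<m. q n k * g n (x k n) j)"
      unfolding usage_def using y(2)[OF that] by (intro sum_mono)
    also have "\<dots> = (\<Sum>n\<in>UNIV. \<Sum>k<m. p k * g n (x k n) j)"
      using q_eq[of "Some j"] that by (simp add: F_def f_def)
    also have "\<dots> = (\<Sum>k<m. p k * usage (x k) j)"
      unfolding usage_def by (subst sum.swap) (simp add: sum_distrib_left)
    finally show ?thesis .
  qed
  moreover have "(\<Sum>k<m. p k * gain (x k)) - (real (card J) + 1) * D \<le> gain y"
  proof -
    have "(\<Sum>k<m. p k * gain (x k)) = (\<Sum>n\<in>UNIV. \<Sum>k<m. p k * r n (x k n))"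
      unfolding gain_def by (subst sum.swap) (simp add: sum_distrib_left)
    also have "\<dots> = (\<Sum>n\<in>UNIV. \<Sum>k<m. q n k * r n (x k n))"
      using q_eq[of None] by (simp add: F_def f_def)
    also have "\<dots> \<le> (\<Sum>n\<in>UNIV. r n (y n) + (if n \<in> ?mixed then D else 0))"
      using y(3) by (intro sum_mono) (simp add: diff_le_eq)
    also have "\<dots> = gain y + real (card ?mixed) * D"
      unfolding gain_def by (simp only: sum.distrib sum.If_cases[OF finite]) simp
    also have "\<dots> \<le> gain y + (real (card J) + 1) * D"
      using few card_F oscillation_nonneg by (intro add_left_mono mult_right_mono) simp_all
    finally show ?thesis by simp
  qed
  ultimately show thesis using y(1) by (intro that[of y]) auto
qed

text \<open>
  The set of attainable totals is compact, being a continuous image of the product of the compact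
  outcome sets. This is why continuous functions of the totals attain their bounds over the
  choices, although the choices themselves carry no topology.
\<close>

lemma compact_image_outcomes:
  fixes \<Phi> :: "('j \<Rightarrow> real) \<Rightarrow> real \<Rightarrow> real"
  assumes "continuous_on UNIV (\<lambda>z. \<Phi> (fst z) (snd z))"
  shows "compact ((\<lambda>x. \<Phi> (usage x) (gain x)) ` Pi UNIV A)"
proof -
  let ?O = "\<lambda>n. (\<lambda>x. (g n x, r n x)) ` A n"
  let ?total = "\<lambda>y::'n \<Rightarrow> ('j \<Rightarrow> real) \<times> real. ((\<lambda>j. \<Sum>n\<in>UNIV. fst (y n) j), (\<Sum>n\<in>UNIV. snd (y n)))"
  have comp: "continuous_on UNIV (\<lambda>y::'n \<Rightarrow> ('j \<Rightarrow> real) \<times> real. y n)" for n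
    by (rule continuous_on_product_coordinates)
  have "continuous_on UNIV ?total"
    by (intro continuous_intros continuous_on_sum
        continuous_on_product_then_coordinatewise[OF continuous_on_fst] comp)
  then have "continuous_on UNIV (\<lambda>y. \<Phi> (fst (?total y)) (snd (?total y)))"
    by (rule continuous_on_compose2[OF assms]) auto
  moreover have "compact (Pi UNIV ?O)" by (intro compact_Pi_UNIV compact_outcomes)
  ultimately have "compact ((\<lambda>y. \<Phi> (fst (?total y)) (snd (?total y))) ` Pi UNIV ?O)"
    using compact_continuous_image continuous_on_subset by blast
  also have "Pi UNIV ?O = (\<lambda>x n. (g n (x n), r n (x n))) ` Pi UNIV A"
  proof
    show "Pi UNIV ?O \<subseteq> (\<lambda>x n. (g n (x n), r n (x n))) ` Pi UNIV A"
    proof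
      fix y assume "y \<in> Pi UNIV ?O"
      then have "\<forall>n. \<exists>x. x \<in> A n \<and> y n = (g n x, r n x)" by auto
      then obtain x where "\<And>n. x n \<in> A n" "\<And>n. y n = (g n (x n), r n (x n))" by metis
      then show "y \<in> (\<lambda>x n. (g n (x n), r n (x n))) ` Pi UNIV A"
        by (intro image_eqI[of _ _ x]) auto
    qed
  qed auto
  finally show ?thesis
    by (simp add: image_image usage_def[abs_def] gain_def)
qed

text \<open>
  The least value of the excess is attained, and an attained value \<open>0\<close> would give feasible choices
  earning at least \<open>v\<close>.
\<close>

lemma excess_bounded_away_from_0:
  assumes "\<And>x. x \<in> Pi UNIV A \<Longrightarrow> \<forall>j\<in>J. usage x j \<le> b j \<Longrightarrow> gain x < v"
  obtains e where "0 < e" "\<And>x. x \<in> Pi UNIV A \<Longrightarrow> e \<le> excess v (usage x) (gain x)"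
proof -
  have coord: "continuous_on UNIV (\<lambda>z::('j \<Rightarrow> real) \<times> real. fst z j)" for j
    by (intro continuous_on_product_then_coordinatewise[OF continuous_on_fst] continuous_intros)
  have "continuous_on UNIV (\<lambda>z. excess v (fst z) (snd z))"
    unfolding excess_def by (intro continuous_intros coord)
  then have "compact ((\<lambda>x. excess v (usage x) (gain x)) ` Pi UNIV A)" (is "compact ?E")
    by (rule compact_image_outcomes)
  moreover have "?E \<noteq> {}" using feasible by blast
  ultimately have "\<exists>e\<in>?E. \<forall>e'\<in>?E. e \<le> e'" by (rule compact_attains_inf)
  then obtain e where e: "e \<in> ?E" "\<forall>e'\<in>?E. e \<le> e'" by (elim bexE)
  from e(1) obtain x where x: "x \<in> Pi UNIV A" "e = excess v (usage x) (gain x)"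
    by (elim imageE)
  have least: "e \<le> excess v (usage y) (gain y)" if "y \<in> Pi UNIV A" for y
    by (rule e(2)[rule_format]) (use that in simp)
  have "0 < e"
  proof (rule ccontr)
    assume "\<not> 0 < e"
    moreover have "0 \<le> (\<Sum>j\<in>J. (max 0 (usage x j - b j))\<^sup>2)" by (intro sum_nonneg) simp
    moreover have "0 \<le> (max 0 (v - gain x))\<^sup>2" by simp
    ultimately have zero: "(\<Sum>j\<in>J. (max 0 (usage x j - b j))\<^sup>2) = 0" "(max 0 (v - gain x))\<^sup>2 = 0"
      using x(2) unfolding excess_def by linarith+
    from zero(1) have "\<forall>j\<in>J. (max 0 (usage x j - b j))\<^sup>2 = 0"
      by (simp only: sum_nonneg_eq_0_iff[OF finite_J zero_le_power2])
    then have "\<forall>j\<in>J. usage x j \<le> b j" by (simp flip: max.absorb_iff1)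
    from assms[OF x(1) this] zero(2) show False by simp
  qed
  then show thesis using least that by blast
qed

lemma excess_translate: "excess v u (w - d) = excess (v + d) u w"
  by (simp add: excess_def algebra_simps)

lemma excess_mono:
  assumes "\<And>j. j \<in> J \<Longrightarrow> u j \<le> u' j" "w' \<le> w"
  shows "excess v u w \<le> excess v u' w'"
  unfolding excess_def using assms by (intro add_mono sum_mono power_mono max.mono) auto

lemma mixturesE:
  assumes "z \<in> mixtures"
  obtains m p x where "convex_weights m p" "\<forall>k<m. x k \<in> Pi UNIV A"
    "fst z = (\<lambda>j. \<Sum>k<m. p k * usage (x k) j)" "snd z = (\<Sum>k<m. p k * gain (x k))"
  using assms unfolding mixtures_def by auto

text \<open>
  The attainable pairs give the directions in which the first-order condition at a point of the
  hull is tested; mixing in one more choice with the weight \<open>s\<close> moves towards such a pair.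
\<close>

lemma mixtures_step:
  assumes z: "z \<in> mixtures" and y: "y \<in> Pi UNIV A" and s: "0 \<le> s" "s \<le> 1"
  shows "((\<lambda>j. fst z j + s * (usage y j - fst z j)), snd z + s * (gain y - snd z)) \<in> mixtures"
proof -
  obtain m p x where mpx: "convex_weights m p" "\<forall>k<m. x k \<in> Pi UNIV A"
    "fst z = (\<lambda>j. \<Sum>k<m. p k * usage (x k) j)" "snd z = (\<Sum>k<m. p k * gain (x k))"
    using mixturesE[OF z] .
  define p' where "p' k = (if k < m then (1 - s) * p k else s)" for k
  define x' where "x' k = (if k < m then x k else y)" for k
  have shift: "(\<Sum>k<Suc m. p' k * \<phi> (x' k)) = (\<Sum>k<m. p k * \<phi> (x k)) + s * (\<phi> y - (\<Sum>k<m. p k * \<phi> (x k)))"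
    for \<phi> :: "('n \<Rightarrow> 'c) \<Rightarrow> real"
    by (simp add: p'_def x'_def algebra_simps sum_subtractf sum_distrib_left)
  have "convex_weights (Suc m) p'"
    using mpx(1) s shift[of "\<lambda>_. 1"] by (auto simp: convex_weights_def p'_def)
  moreover have "\<forall>k<Suc m. x' k \<in> Pi UNIV A" using mpx(2) y by (simp add: x'_def)
  ultimately have "((\<lambda>j. \<Sum>k<Suc m. p' k * usage (x' k) j), (\<Sum>k<Suc m. p' k * gain (x' k))) \<in> mixtures"
    unfolding mixtures_def by blast
  then show ?thesis
    unfolding shift[of gain] shift[of "\<lambda>x. usage x _"] mpx(3,4) by simp
qed

lemma mixtures_base:
  assumes "x \<in> Pi UNIV A"
  shows "(usage x, gain x) \<in> mixtures"
  unfolding mixtures_def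
  by (intro CollectI exI[of _ 1] exI[of _ "\<lambda>_. 1"] exI[of _ "\<lambda>_. x"])
    (use assms in \<open>auto simp: convex_weights_def\<close>)

lemma mixtures_diameter:
  obtains M where "0 \<le> M" "\<And>z y. z \<in> mixtures \<Longrightarrow> y \<in> Pi UNIV A \<Longrightarrow>
    (\<Sum>j\<in>J. (usage y j - fst z j)\<^sup>2) + (gain y - snd z)\<^sup>2 \<le> M"
proof -
  have coord: "continuous_on UNIV (\<lambda>z::('j \<Rightarrow> real) \<times> real. fst z j)" for j
    by (intro continuous_on_product_then_coordinatewise[OF continuous_on_fst] continuous_intros)
  have "compact ((\<lambda>x. (\<Sum>j\<in>J. \<bar>usage x j\<bar>) + \<bar>gain x\<bar>) ` Pi UNIV A)"
    by (rule compact_image_outcomes[of "\<lambda>u w. (\<Sum>j\<in>J. \<bar>u j\<bar>) + \<bar>w\<bar>"]) (intro continuous_intros coord)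
  then have "bounded ((\<lambda>x. (\<Sum>j\<in>J. \<bar>usage x j\<bar>) + \<bar>gain x\<bar>) ` Pi UNIV A)"
    by (rule compact_imp_bounded)
  then obtain K where K0: "\<forall>x\<in>Pi UNIV A. norm ((\<Sum>j\<in>J. \<bar>usage x j\<bar>) + \<bar>gain x\<bar>) \<le> K"
    unfolding bounded_iff by auto
  have K: "(\<Sum>j\<in>J. \<bar>usage x j\<bar>) + \<bar>gain x\<bar> \<le> K" if "x \<in> Pi UNIV A" for x
    using K0 that by fastforce
  have Ku: "\<bar>usage x j\<bar> \<le> K" if "x \<in> Pi UNIV A" "j \<in> J" for x j
    using K[OF that(1)] member_le_sum[OF that(2), of "\<lambda>j. \<bar>usage x j\<bar>"] finite_J by force
  have Kg: "\<bar>gain x\<bar> \<le> K" if "x \<in> Pi UNIV A" for x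
    using K[OF that] sum_nonneg[of J "\<lambda>j. \<bar>usage x j\<bar>", OF abs_ge_zero] by linarith
  have avg: "\<bar>\<Sum>k<m. p k * u k\<bar> \<le> K" if "convex_weights m p" "\<And>k. k < m \<Longrightarrow> \<bar>u k\<bar> \<le> K"
    for m p and u :: "nat \<Rightarrow> real"
  proof -
    have "\<bar>\<Sum>k<m. p k * u k\<bar> \<le> (\<Sum>k<m. \<bar>p k * u k\<bar>)" by (rule sum_abs)
    also have "\<dots> \<le> (\<Sum>k<m. p k * K)"
      using that by (intro sum_mono) (auto simp: abs_mult convex_weights_def intro!: mult_left_mono)
    also have "\<dots> = K" using that(1) by (simp add: convex_weights_def flip: sum_distrib_right)
    finally show ?thesis .
  qed
  have sq: "(s - t)\<^sup>2 \<le> (2 * K)\<^sup>2" if "\<bar>s\<bar> \<le> K" "\<bar>t\<bar> \<le> K" for s t :: real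
  proof -
    have "\<bar>s - t\<bar> \<le> \<bar>2 * K\<bar>" using that by linarith
    then show ?thesis by (simp only: abs_le_square_iff)
  qed
  show thesis
  proof (rule that)
    show "0 \<le> (\<Sum>j\<in>J. (2 * K)\<^sup>2) + (2 * K)\<^sup>2" by (simp add: sum_nonneg)
    fix z y assume "z \<in> mixtures" and y: "y \<in> Pi UNIV A"
    from \<open>z \<in> mixtures\<close> obtain m p x where mpx: "convex_weights m p" "\<forall>k<m. x k \<in> Pi UNIV A"
      "fst z = (\<lambda>j. \<Sum>k<m. p k * usage (x k) j)" "snd z = (\<Sum>k<m. p k * gain (x k))"
      by (rule mixturesE)
    have "\<bar>fst z j\<bar> \<le> K" if "j \<in> J" for j
      unfolding mpx(3) using mpx that Ku by (intro avg) auto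
    moreover have "\<bar>snd z\<bar> \<le> K"
      unfolding mpx(4) using mpx Kg by (intro avg) auto
    ultimately show "(\<Sum>j\<in>J. (usage y j - fst z j)\<^sup>2) + (gain y - snd z)\<^sup>2
        \<le> (\<Sum>j\<in>J. (2 * K)\<^sup>2) + (2 * K)\<^sup>2"
      using y Ku Kg by (intro add_mono sum_mono sq) auto
  qed
qed

text \<open>
  If no feasible choices earn \<open>v\<close>, then by rounding no point of the hull comes close to the
  supply-respecting pairs that earn \<open>c = v + (card J + 1) * D\<close>: its excess over the target \<open>c\<close> is at
  least the excess of the rounded choices over the target \<open>v\<close>, hence at least some \<open>e > 0\<close>. A near
  minimiser of the excess over the hull satisfies an approximate first-order condition in the
  direction of every attainable pair, which says that the gradient at this point separates the hull
  from the target quadrant. All its coefficients are nonnegative up to the sign of the reward, and since some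
  choices are feasible the coefficient of the reward does not vanish; dividing by it gives the
  multipliers. Using a near minimiser instead of a
  minimiser avoids showing that the hull is closed.
\<close>

lemma Lagrange_multipliers_duality_gap:
  assumes "\<And>x. x \<in> Pi UNIV A \<Longrightarrow> \<forall>j\<in>J. usage x j \<le> b j \<Longrightarrow> gain x < v"
  obtains \<mu> where "\<And>j. j \<in> J \<Longrightarrow> 0 \<le> \<mu> j"
    and "\<And>x. x \<in> Pi UNIV A \<Longrightarrow>
      gain x + (\<Sum>j\<in>J. \<mu> j * (b j - usage x j)) \<le> v + (real (card J) + 1) * D"
proof -
  define c where "c = v + (real (card J) + 1) * D"
  obtain e where e: "0 < e" "\<And>x. x \<in> Pi UNIV A \<Longrightarrow> e \<le> excess v (usage x) (gain x)"
    using excess_bounded_away_from_0 assms by blast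
  have e_mixtures: "e \<le> excess c (fst z) (snd z)" if zm: "z \<in> mixtures" for z
  proof -
    obtain m p x where mpx: "convex_weights m p" "\<forall>k<m. x k \<in> Pi UNIV A"
      "fst z = (\<lambda>j. \<Sum>k<m. p k * usage (x k) j)" "snd z = (\<Sum>k<m. p k * gain (x k))"
      using mixturesE[OF zm] .
    obtain y where y: "y \<in> Pi UNIV A"
      "\<forall>j\<in>J. usage y j \<le> (\<Sum>k<m. p k * usage (x k) j)"
      "(\<Sum>k<m. p k * gain (x k)) - (real (card J) + 1) * D \<le> gain y"
      using rounding[OF mpx(1,2)] .
    have "e \<le> excess v (usage y) (gain y)" using e(2) y(1) .
    also have "\<dots> \<le> excess v (fst z) (snd z - (real (card J) + 1) * D)"
      using y by (intro excess_mono) (auto simp: mpx(3,4))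
    also have "\<dots> = excess c (fst z) (snd z)"
      unfolding c_def by (rule excess_translate)
    finally show ?thesis .
  qed
  obtain M where M: "0 \<le> M" "\<And>z y. z \<in> mixtures \<Longrightarrow> y \<in> Pi UNIV A \<Longrightarrow>
    (\<Sum>j\<in>J. (usage y j - fst z j)\<^sup>2) + (gain y - snd z)\<^sup>2 \<le> M"
    using mixtures_diameter by blast
  \<comment> \<open>The step \<open>s\<close> and the precision \<open>s * (e / 2)\<close> of the near minimiser are chosen such that the
    second-order term of the excess, at most \<open>s * (s * M)\<close>, is dominated by \<open>s * (e / 2)\<close> as well.\<close>
  define s where "s = min 1 (e / 2 / (M + 1))"
  have s: "0 < s" "s \<le> 1" and sM: "s * M \<le> e / 2"
  proof -
    show "0 < s" "s \<le> 1" using e M by (auto simp: s_def)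
    have "s * M \<le> s * (M + 1)" using \<open>0 < s\<close> by simp
    also have "\<dots> \<le> e / 2 / (M + 1) * (M + 1)"
      using M by (intro mult_right_mono) (auto simp: s_def)
    also have "\<dots> = e / 2"
      using nonzero_eq_divide_eq[of "M + 1" "e / 2 / (M + 1)" "e / 2"] M(1) by simp
    finally show "s * M \<le> e / 2" .
  qed
  obtain x0 where x0: "x0 \<in> Pi UNIV A" "\<forall>j\<in>J. usage x0 j \<le> b j"
    using feasible unfolding usage_def by blast
  obtain z where z: "z \<in> mixtures"
    and near: "\<And>w. w \<in> mixtures \<Longrightarrow> excess c (fst z) (snd z) \<le> excess c (fst w) (snd w) + s * (e / 2)"
  proof -
    let ?E = "(\<lambda>z. excess c (fst z) (snd z)) ` mixtures"
    have bdd: "bdd_below ?E" using e_mixtures by (intro bdd_belowI2)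
    have "Inf ?E < Inf ?E + s * (e / 2)" using s e by simp
    then obtain z where "z \<in> mixtures" "excess c (fst z) (snd z) < Inf ?E + s * (e / 2)"
      using cInf_lessD[of ?E] mixtures_base[OF x0(1)] by blast
    moreover have "Inf ?E \<le> excess c (fst w) (snd w)" if "w \<in> mixtures" for w
      using bdd that by (intro cINF_lower)
    ultimately show ?thesis using that[of z] by fastforce
  qed
  \<comment> \<open>Up to the factor 2 and the sign of the reward component, \<open>(\<mu>0, \<sigma>)\<close> is the gradient of the
    excess at \<open>z\<close>.\<close>
  define \<mu>0 where "\<mu>0 j = max 0 (fst z j - b j)" for j
  define \<sigma> where "\<sigma> = max 0 (c - snd z)"
  have key: "0 < (\<Sum>j\<in>J. \<mu>0 j * (usage y j - b j)) + \<sigma> * (c - gain y)" if y: "y \<in> Pi UNIV A" for y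
  proof -
    define d where "d j = usage y j - fst z j" for j
    define \<delta> where "\<delta> = snd z - gain y"
    define G where "G = (\<Sum>j\<in>J. \<mu>0 j * d j) + \<sigma> * \<delta>"
    define Q where "Q = (\<Sum>j\<in>J. (d j)\<^sup>2) + \<delta>\<^sup>2"
    have "excess c (fst z) (snd z) \<le> excess c (\<lambda>j. fst z j + s * d j) (snd z - s * \<delta>) + s * (e / 2)"
    proof -
      have "snd z + s * (gain y - snd z) = snd z - s * \<delta>" by (simp add: \<delta>_def algebra_simps)
      then show ?thesis using near[OF mixtures_step[OF z y, of s]] s by (simp add: d_def)
    qed
    also have "excess c (\<lambda>j. fst z j + s * d j) (snd z - s * \<delta>)
      \<le> excess c (fst z) (snd z) + 2 * s * G + s * (s * Q)"
    proof -
      have "(max 0 (fst z j + s * d j - b j))\<^sup>2 \<le> (\<mu>0 j)\<^sup>2 + 2 * s * (\<mu>0 j * d j) + s * (s * (d j)\<^sup>2)" for j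
        using power2_max_0_add_le[of "fst z j - b j" "s * d j"]
        by (simp add: \<mu>0_def power2_eq_square algebra_simps)
      then have "(\<Sum>j\<in>J. (max 0 (fst z j + s * d j - b j))\<^sup>2)
        \<le> (\<Sum>j\<in>J. (\<mu>0 j)\<^sup>2 + 2 * s * (\<mu>0 j * d j) + s * (s * (d j)\<^sup>2))"
        by (rule sum_mono)
      also have "\<dots> = (\<Sum>j\<in>J. (\<mu>0 j)\<^sup>2) + 2 * s * (\<Sum>j\<in>J. \<mu>0 j * d j) + s * (s * (\<Sum>j\<in>J. (d j)\<^sup>2))"
        by (simp only: sum.distrib sum_distrib_left)
      finally have "(\<Sum>j\<in>J. (max 0 (fst z j + s * d j - b j))\<^sup>2) \<le> \<dots>" .
      moreover have "(max 0 (c - (snd z - s * \<delta>)))\<^sup>2 \<le> \<sigma>\<^sup>2 + 2 * s * (\<sigma> * \<delta>) + s * (s * \<delta>\<^sup>2)"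
        using power2_max_0_add_le[of "c - snd z" "s * \<delta>"]
        by (simp add: \<sigma>_def power2_eq_square algebra_simps)
      ultimately show ?thesis
        unfolding excess_def G_def Q_def \<mu>0_def[symmetric] \<sigma>_def[symmetric] distrib_left by linarith
    qed
    also have "s * (s * Q) \<le> s * (e / 2)"
    proof -
      have "s * Q \<le> s * M" unfolding Q_def d_def \<delta>_def power2_commute[of "snd z"] using s M(2)[OF z y] by (intro mult_left_mono) auto
      then show ?thesis using sM s by (intro mult_left_mono) linarith+
    qed
    finally have "0 \<le> 2 * s * (G + e / 2)" by (simp add: algebra_simps)
    then have G: "- (e / 2) \<le> G" using s by (simp add: zero_le_mult_iff)
    have "(\<Sum>j\<in>J. \<mu>0 j * (usage y j - b j)) + \<sigma> * (c - gain y)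
      = G + (\<Sum>j\<in>J. \<mu>0 j * (fst z j - b j)) + \<sigma> * (c - snd z)"
      unfolding G_def d_def \<delta>_def by (simp add: algebra_simps sum_subtractf sum.distrib)
    also have "(\<Sum>j\<in>J. \<mu>0 j * (fst z j - b j)) = (\<Sum>j\<in>J. (\<mu>0 j)\<^sup>2)"
      by (intro sum.cong) (auto simp: \<mu>0_def max_def power2_eq_square)
    also have "\<sigma> * (c - snd z) = \<sigma>\<^sup>2" by (auto simp: \<sigma>_def max_def power2_eq_square)
    finally show ?thesis
      using G e(1) e_mixtures[OF z] unfolding excess_def \<mu>0_def \<sigma>_def by linarith
  qed
  have "0 < \<sigma>"
  proof (rule ccontr)
    assume "\<not> 0 < \<sigma>"
    then have "\<sigma> = 0" by (simp add: \<sigma>_def)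
    moreover have "(\<Sum>j\<in>J. \<mu>0 j * (usage x0 j - b j)) \<le> 0"
      using x0(2) by (intro sum_nonpos mult_nonneg_nonpos) (auto simp: \<mu>0_def)
    ultimately show False using key[OF x0(1)] by simp
  qed
  show thesis
  proof (rule that)
    show "0 \<le> \<mu>0 j / \<sigma>" for j using \<open>0 < \<sigma>\<close> by (simp add: \<mu>0_def)
    fix x assume "x \<in> Pi UNIV A"
    have "(\<Sum>j\<in>J. \<mu>0 j / \<sigma> * (b j - usage x j)) = - (\<Sum>j\<in>J. \<mu>0 j * (usage x j - b j)) / \<sigma>"
      unfolding sum_negf[symmetric] sum_divide_distrib
      by (intro sum.cong) (simp_all add: algebra_simps diff_divide_distrib)
    also have "\<dots> \<le> c - gain x"
      using key[OF \<open>x \<in> Pi UNIV A\<close>] \<open>0 < \<sigma>\<close> by (simp add: field_simps)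
    finally show "gain x + (\<Sum>j\<in>J. \<mu>0 j / \<sigma> * (b j - usage x j)) \<le> v + (real (card J) + 1) * D"
      by (simp add: c_def)
  qed
qed

end

section \<open>Trajectories and feasible controls\<close>

lemma project_state_cong:
  assumes "\<And>s. s < t \<Longrightarrow> c s = c' s"
  shows "project_state W n c \<omega> t = project_state W n c' \<omega> t"
proof -
  have "map c [0..<t] = map c' [0..<t]" using assms by (intro map_cong) auto
  then show ?thesis by (simp only: project_state_def)
qed

lemma joint_state_cong:
  "(\<And>s. s < t \<Longrightarrow> a s = a' s) \<Longrightarrow> joint_state W a \<omega> t = joint_state W a' \<omega> t"
  unfolding joint_state_def by (intro ext project_state_cong) simp

lemma project_state_in_space:
  assumes "scenario_model W" "\<omega> \<in> space (scenarios W)"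
    and "\<And>s. s < t \<Longrightarrow> c s \<in> actions W n (project_state W n c \<omega> s)"
  shows "project_state W n c \<omega> t \<in> space (states W n)"
proof -
  have "(\<forall>s < length (map c [0..<t]). map c [0..<t] ! s \<in> actions W n (traj W n (take s (map c [0..<t])) \<omega>))"
    using assms(3) by (simp add: project_state_def take_map)
  with assms(1,2) show ?thesis
    unfolding scenario_model_def project_state_def by blast
qed

lemma project_controls_graph:
  assumes "scenario_model W" "\<omega> \<in> space (scenarios W)" "c \<in> project_controls W n \<omega> T" "t \<le> T"
  shows "(project_state W n c \<omega> t, c t) \<in> project_graph W n"
proof -
  have "c s \<in> actions W n (project_state W n c \<omega> s)" if "s \<le> T" for s
    using assms(3) that by (simp add: project_controls_def)
  then show ?thesis
    using project_state_in_space[OF assms(1,2), of t c n] assms(4) by (simp add: project_graph_def)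
qed

lemma joint_controls_iff:
  "a \<in> joint_controls W \<omega> T \<longleftrightarrow> (\<lambda>n t. a t n) \<in> (\<Pi> n\<in>UNIV. project_controls W n \<omega> T)"
  by (auto simp: joint_controls_def project_controls_def joint_actions_def joint_state_def)

lemma feasible_controls_iff:
  "a \<in> feasible_controls W \<omega> T \<longleftrightarrow> a \<in> joint_controls W \<omega> T \<and>
    (\<forall>t\<le>T. (\<Sum>n\<in>UNIV. project_cons_at W n \<omega> t (\<lambda>s. a s n)) \<le> budget W)"
  by (auto simp: feasible_controls_def joint_controls_def feasible_actions_def joint_cons_def
      project_cons_at_def joint_state_def)

text \<open>
  The controls are chosen one period at a time: the state reached by feasible controls lies in the
  state space, where a feasible action exists.
\<close>

lemma feasible_controls_nonempty:
  assumes "assumption1 W" "scenario_model W" "\<omega> \<in> space (scenarios W)"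
  shows "feasible_controls W \<omega> T \<noteq> {}"
proof -
  have "\<exists>a. (\<forall>t<k. a t \<in> feasible_actions W (joint_state W a \<omega> t)) \<and> (\<forall>t\<ge>k. \<forall>n. a t n = 0)" for k
  proof (induction k)
    case 0
    show ?case by (intro exI[of _ "\<lambda>_ _. 0"]) simp
  next
    case (Suc k)
    then obtain a where a: "\<And>t. t < k \<Longrightarrow> a t \<in> feasible_actions W (joint_state W a \<omega> t)"
      "\<And>t n. k \<le> t \<Longrightarrow> a t n = 0" by blast
    have "project_state W n (\<lambda>s. a s n) \<omega> k \<in> space (states W n)" for n
      using a(1) by (intro project_state_in_space assms)
        (auto simp: feasible_actions_def joint_actions_def joint_state_def)
    then have "joint_state W a \<omega> k \<in> space (joint_states W)"
      by (simp add: joint_state_def joint_states_def space_PiM PiE_iff)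
    then obtain u where u: "u \<in> feasible_actions W (joint_state W a \<omega> k)"
      using assms(1) unfolding assumption1_def by blast
    define a' where "a' = a(k := u)"
    have a': "a' k = u" "\<And>t. t \<noteq> k \<Longrightarrow> a' t = a t" by (auto simp: a'_def)
    have "joint_state W a' \<omega> t = joint_state W a \<omega> t" if "t \<le> k" for t
      using that by (intro joint_state_cong a') auto
    then show ?case using a u a' by (intro exI[of _ a']) (auto simp: less_Suc_eq)
  qed
  from this[of "Suc T"] obtain a where
    "\<forall>t<Suc T. a t \<in> feasible_actions W (joint_state W a \<omega> t)" "\<forall>t\<ge>Suc T. \<forall>n. a t n = 0" by blast
  then have "a \<in> feasible_controls W \<omega> T" by (simp add: feasible_controls_def less_Suc_eq_le Suc_le_eq)
  then show ?thesis by blast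
qed

section \<open>Separable value functions\<close>

lemma expectation_abs_le:
  fixes f :: "'b \<Rightarrow> real"
  assumes "prob_space M" "f \<in> borel_measurable M" "\<And>x. x \<in> space M \<Longrightarrow> \<bar>f x\<bar> \<le> C"
  shows "integrable M f" "\<bar>\<integral>x. f x \<partial>M\<bar> \<le> C"
proof -
  interpret prob_space M by fact
  have bounds: "AE x in M. f x \<le> C" "AE x in M. - C \<le> f x"
    using assms(3) by (auto intro!: AE_I2 simp: abs_le_iff) (metis abs_le_iff minus_le_iff)
  show int: "integrable M f"
    using assms by (intro integrable_const_bound[of _ C]) auto
  show "\<bar>\<integral>x. f x \<partial>M\<bar> \<le> C"
    using integral_le_const[OF int bounds(1)] integral_ge_const[OF int bounds(2)] by linarith
qed

locale separable_wcdp =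
  fixes W :: "('n::finite, 'x, 'a::euclidean_space, 'l::finite, 'w) wcdp"
    and h :: "'n \<Rightarrow> 'x \<Rightarrow> real"
    and H :: "('n \<Rightarrow> 'x) \<Rightarrow> real"
    and \<theta> :: real
  assumes wcdp: "is_wcdp W"
    and scenario_model: "scenario_model W"
    and h_measurable: "\<And>n. h n \<in> borel_measurable (states W n)"
    and h_bounded: "\<And>n. \<exists>C. \<forall>x \<in> space (states W n). \<bar>h n x\<bar> \<le> C"
    and H_eq: "\<And>x. x \<in> space (joint_states W) \<Longrightarrow> H x = \<theta> + (\<Sum>n\<in>UNIV. h n (x n))"
    and feasible_action_exists: "assumption1 W"
    and outcomes_compact: "\<And>\<omega> T. \<omega> \<in> space (scenarios W) \<Longrightarrow> assumption2 W h \<omega> T"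
    and convex_closure_attained: "\<And>\<omega> T. \<omega> \<in> space (scenarios W) \<Longrightarrow> assumption3 W \<omega> T"
begin

lemma discount: "0 < discount W" "discount W < 1"
  using wcdp by (auto simp: is_wcdp_def)

lemma kernel:
  assumes "(x, a) \<in> project_graph W n"
  shows "prob_space (kernel W n x a)" "sets (kernel W n x a) = sets (states W n)"
proof -
  have "(\<lambda>(x, a). kernel W n x a)
      \<in> measurable (restrict_space (states W n \<Otimes>\<^sub>M borel) (project_graph W n)) (prob_algebra (states W n))"
    using wcdp by (simp add: is_wcdp_def)
  moreover have "(x, a) \<in> space (restrict_space (states W n \<Otimes>\<^sub>M borel) (project_graph W n))"
    using assms by (auto simp: space_restrict_space space_pair_measure project_graph_def)
  ultimately have "(\<lambda>(x, a). kernel W n x a) (x, a) \<in> space (prob_algebra (states W n))"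
    by (rule measurable_space)
  then show "prob_space (kernel W n x a)" "sets (kernel W n x a) = sets (states W n)"
    by (auto simp: space_prob_algebra)
qed

lemma expectation_h:
  assumes "(x, a) \<in> project_graph W n" "\<And>y. y \<in> space (states W n) \<Longrightarrow> \<bar>h n y\<bar> \<le> C"
  shows "h n \<in> borel_measurable (kernel W n x a)" "integrable (kernel W n x a) (h n)"
    "\<bar>\<integral>y. h n y \<partial>kernel W n x a\<bar> \<le> C"
proof -
  note k = kernel[OF assms(1)]
  show meas: "h n \<in> borel_measurable (kernel W n x a)"
    using h_measurable measurable_cong_sets[OF k(2) refl] by blast
  have "\<bar>h n y\<bar> \<le> C" if "y \<in> space (kernel W n x a)" for y
    using assms(2) that sets_eq_imp_space_eq[OF k(2)] by simp
  then show "integrable (kernel W n x a) (h n)" "\<bar>\<integral>y. h n y \<partial>kernel W n x a\<bar> \<le> C"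
    using expectation_abs_le[OF k(1) meas] by auto
qed

text \<open>
  The marginals of the product law are the laws of the single projects, so the expectation of an
  additively separable function splits over the projects. This is what decouples the penalised
  problem.
\<close>

lemma expectation_H:
  assumes "\<And>n. (x n, a n) \<in> project_graph W n"
  shows "(\<integral>y. H y \<partial>joint_kernel W x a) = \<theta> + (\<Sum>n\<in>UNIV. \<integral>y. h n y \<partial>kernel W n (x n) (a n))"
proof -
  let ?M = "\<lambda>n. kernel W n (x n) (a n)"
  let ?P = "Pi\<^sub>M UNIV ?M"
  interpret P: prob_space ?P by (intro prob_space_PiM kernel assms)
  have sp: "space ?P = space (joint_states W)"
    unfolding joint_states_def space_PiM by (simp add: sets_eq_imp_space_eq[OF kernel(2)[OF assms]])
  have marginal: "distr ?P (?M n) (\<lambda>y. y n) = ?M n" for n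
    by (intro distr_PiM_component kernel assms) simp
  have h_kernel: "h n \<in> borel_measurable (?M n)" "integrable (?M n) (h n)" for n
    using h_bounded[of n] expectation_h[OF assms[of n]] by blast+
  have int: "integrable ?P (\<lambda>y. h n (y n))" for n
    using h_kernel(2)[of n] h_kernel(1)[of n]
    by (subst (asm) marginal[symmetric]) (simp add: integrable_distr_eq)
  have val: "(\<integral>y. h n (y n) \<partial>?P) = (\<integral>y. h n y \<partial>?M n)" for n
  proof -
    have "(\<integral>y. h n y \<partial>?M n) = (\<integral>y. h n y \<partial>distr ?P (?M n) (\<lambda>y. y n))" by (simp only: marginal)
    also have "\<dots> = (\<integral>y. h n (y n) \<partial>?P)" using h_kernel(1)[of n] by (intro integral_distr) simp_all
    finally show ?thesis ..
  qed
  have "(\<integral>y. H y \<partial>joint_kernel W x a) = (\<integral>y. \<theta> + (\<Sum>n\<in>UNIV. h n (y n)) \<partial>?P)"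
    unfolding joint_kernel_def by (intro Bochner_Integration.integral_cong) (auto simp: sp H_eq)
  also have "\<dots> = (\<integral>y. \<theta> \<partial>?P) + (\<integral>y. (\<Sum>n\<in>UNIV. h n (y n)) \<partial>?P)"
    by (intro Bochner_Integration.integral_add Bochner_Integration.integrable_sum int) simp
  also have "\<dots> = \<theta> + (\<Sum>n\<in>UNIV. \<integral>y. h n y \<partial>?M n)"
    using int by (simp add: val P.prob_space Bochner_Integration.integral_sum)
  finally show ?thesis .
qed

lemma drift_bounded: "\<exists>C. \<forall>(x, a) \<in> project_graph W n. \<bar>project_drift W h n x a\<bar> \<le> C"
proof -
  obtain C where C: "\<And>x. x \<in> space (states W n) \<Longrightarrow> \<bar>h n x\<bar> \<le> C" using h_bounded by blast
  obtain R where R: "\<And>x a. (x, a) \<in> project_graph W n \<Longrightarrow> \<bar>reward W n x a\<bar> \<le> R"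
    using wcdp unfolding is_wcdp_def by fast
  have "\<bar>project_drift W h n x a\<bar> \<le> R + C + C" if xa: "(x, a) \<in> project_graph W n" for x a
  proof -
    have "\<bar>discount W * (\<integral>y. h n y \<partial>kernel W n x a)\<bar> \<le> 1 * C"
      unfolding abs_mult using discount expectation_h(3)[OF xa C]
      by (intro mult_mono) auto
    moreover have "\<bar>h n x\<bar> \<le> C" using C xa by (simp add: project_graph_def)
    ultimately show ?thesis unfolding project_drift_def using R[OF xa] by linarith
  qed
  then show ?thesis by blast
qed

lemma drift_diff_le_project_gap:
  assumes "(x, a) \<in> project_graph W n" "(y, c) \<in> project_graph W n"
  shows "project_drift W h n x a - project_drift W h n y c \<le> project_gap W h n"
proof -
  let ?f = "\<lambda>(x, a). project_drift W h n x a"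
  obtain C where "\<forall>z \<in> project_graph W n. \<bar>?f z\<bar> \<le> C" 
    using drift_bounded[of n] by (auto simp: split_beta)
  then have "bdd_above (?f ` project_graph W n)" "bdd_below (?f ` project_graph W n)"
    by (auto intro!: bdd_aboveI2[of _ _ C] bdd_belowI2[of _ "- C"] simp: abs_le_iff)
  from cSUP_upper[OF assms(1) this(1)] cINF_lower[OF this(2) assms(2)]
  show ?thesis by (simp add: project_gap_def)
qed

definition max_gap :: real where
  "max_gap = (MAX n. project_gap W h n)"

lemma project_gap_le_max_gap: "project_gap W h n \<le> max_gap"
  unfolding max_gap_def by (intro Max_ge) auto

end

section \<open>The duality gap in one scenario\<close>

locale separable_wcdp_scenario = separable_wcdp W h H \<theta>
  for W :: "('n::finite, 'x, 'a::euclidean_space, 'l::finite, 'w) wcdp"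
    and h :: "'n \<Rightarrow> 'x \<Rightarrow> real"
    and H :: "('n \<Rightarrow> 'x) \<Rightarrow> real"
    and \<theta> :: real +
  fixes \<omega> :: 'w and T :: nat
  assumes scenario: "\<omega> \<in> space (scenarios W)"
begin

text \<open>
  The constraint consumptions of a project as one vector over pairs of a period and a constraint:
  along a horizon \<open>T\<close> there are \<open>(T + 1) * CARD('l)\<close> of them.
\<close>

definition component :: "'n \<Rightarrow> (nat \<Rightarrow> 'a) \<Rightarrow> nat \<times> 'l \<Rightarrow> real" where
  "component n c = (\<lambda>(t, i). (if t \<le> T then project_cons_at W n \<omega> t c else 0) $ i)"

lemma compact_components:
  "compact ((\<lambda>c. (component n c, project_I W h n c \<omega> T)) ` project_controls W n \<omega> T)"
proof -
  let ?\<phi> = "\<lambda>z::(nat \<Rightarrow> 'a) \<times> (nat \<Rightarrow> real ^ 'l) \<times> real. (\<lambda>(t, i). fst (snd z) t $ i, snd (snd z))"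
  have "continuous_on UNIV ?\<phi>"
  proof (intro continuous_on_Pair continuous_on_coordinatewise_then_product)
    fix j :: "nat \<times> 'l"
    have "continuous_on UNIV (\<lambda>z::(nat \<Rightarrow> 'a) \<times> (nat \<Rightarrow> real ^ 'l) \<times> real. fst (snd z) (fst j))"
      by (intro continuous_on_product_then_coordinatewise[OF continuous_on_fst] continuous_intros)
    then show "continuous_on UNIV
        (\<lambda>z::(nat \<Rightarrow> 'a) \<times> (nat \<Rightarrow> real ^ 'l) \<times> real. case j of (t, i) \<Rightarrow> fst (snd z) t $ i)"
      by (cases j) (auto intro: continuous_intros)
  qed (intro continuous_intros)
  moreover have "compact (outcome_set W h n \<omega> T)"
    using outcomes_compact[OF scenario] by (simp add: assumption2_def)
  ultimately have "compact (?\<phi> ` outcome_set W h n \<omega> T)"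
    using compact_continuous_image continuous_on_subset by blast
  also have "?\<phi> ` outcome_set W h n \<omega> T
    = (\<lambda>c. (component n c, project_I W h n c \<omega> T)) ` project_controls W n \<omega> T"
    by (simp add: outcome_set_def image_image component_def)
  finally show ?thesis .
qed

lemma project_cons_at_bdd_below:
  assumes "t \<le> T"
  shows "bdd_below ((\<lambda>c. project_cons_at W n \<omega> t c $ i) ` project_controls W n \<omega> T)"
proof -
  have "continuous_on UNIV (\<lambda>z::(nat \<times> 'l \<Rightarrow> real) \<times> real. fst z (t, i))"
    by (intro continuous_on_product_then_coordinatewise[OF continuous_on_fst] continuous_intros)
  then have "compact ((\<lambda>z. fst z (t, i)) `
      (\<lambda>c. (component n c, project_I W h n c \<omega> T)) ` project_controls W n \<omega> T)"
    using compact_components compact_continuous_image continuous_on_subset by blast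
  then show ?thesis
    using assms by (simp add: image_image component_def bounded_imp_bdd_below compact_imp_bounded)
qed

text \<open>
  The average of the control sequences is a candidate point of the convex closure, and the given
  combination is one of the competitors in the infimum that defines its value there. The infimum is
  below this competitor only because the set of competitors is bounded below.
\<close>

lemma component_convex_like:
  assumes p: "convex_weights m p" and c: "\<forall>k<m. c k \<in> project_controls W n \<omega> T"
  shows "\<exists>y\<in>project_controls W n \<omega> T. \<forall>j\<in>{..T} \<times> UNIV.
    component n y j \<le> (\<Sum>k<m. p k * component n (c k) j)"
proof -
  let ?S = "project_controls W n \<omega> T"
  let ?mix = "\<lambda>t. \<Sum>k<m. p k *\<^sub>R c k t"
  have "?mix \<in> seq_conv ?S" using p c unfolding seq_conv_def by blast
  then obtain y where y: "y \<in> ?S"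
    "\<And>t i. t \<le> T \<Longrightarrow> project_cons_at W n \<omega> t y $ i
       \<le> convex_closure ?S (\<lambda>c. project_cons_at W n \<omega> t c $ i) ?mix"
    using convex_closure_attained[OF scenario] unfolding assumption3_def by blast
  have "convex_closure ?S (\<lambda>c. project_cons_at W n \<omega> t c $ i) ?mix
      \<le> (\<Sum>k<m. p k * project_cons_at W n \<omega> t (c k) $ i)" if t: "t \<le> T" for t i
    unfolding convex_closure_def
  proof (rule cInf_lower)
    let ?f = "\<lambda>c. project_cons_at W n \<omega> t c $ i"
    obtain B where B: "\<And>c. c \<in> ?S \<Longrightarrow> B \<le> ?f c"
      using project_cons_at_bdd_below[OF t, where n = n and i = i] by (auto simp: bdd_below_def)
    have "B \<le> (\<Sum>k<m'. p' k * ?f (a k))"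
      if "convex_weights m' p'" "\<forall>k<m'. a k \<in> ?S" for m' p' a
    proof -
      have "B = (\<Sum>k<m'. p' k * B)"
        using that(1) by (simp add: convex_weights_def flip: sum_distrib_right)
      also have "\<dots> \<le> (\<Sum>k<m'. p' k * ?f (a k))"
        using that B by (intro sum_mono mult_left_mono) (auto simp: convex_weights_def)
      finally show ?thesis .
    qed
    then show "bdd_below {(\<Sum>k<m. p k * ?f (a k)) | m p a.
        convex_weights m p \<and> (\<forall>k<m. a k \<in> ?S) \<and> ?mix = (\<lambda>t. \<Sum>k<m. p k *\<^sub>R a k t)}"
      by (auto simp: bdd_below_def intro!: exI[of _ B])
  qed (use p c in blast)
  then have "project_cons_at W n \<omega> t y $ i \<le> (\<Sum>k<m. p k * project_cons_at W n \<omega> t (c k) $ i)"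
    if "t \<le> T" for t i
    using y(2) that order.trans by blast
  then show ?thesis using y(1) by (intro bexI[of _ y]) (auto simp: component_def)
qed

lemma project_I_oscillation:
  assumes "c \<in> project_controls W n \<omega> T" "d \<in> project_controls W n \<omega> T"
  shows "project_I W h n c \<omega> T - project_I W h n d \<omega> T \<le> real (T + 1) * max_gap"
proof -
  have "project_I W h n c \<omega> T - project_I W h n d \<omega> T
    = (\<Sum>t=0..T. project_drift W h n (project_state W n c \<omega> t) (c t)
        - project_drift W h n (project_state W n d \<omega> t) (d t))"
    by (simp add: project_I_def sum_subtractf)
  also have "\<dots> \<le> (\<Sum>t=0..T. max_gap)"
  proof (rule sum_mono)
    fix t assume "t \<in> {0..T}"
    then have "t \<le> T" by simp
    note graph = project_controls_graph[OF scenario_model scenario _ this]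
    show "project_drift W h n (project_state W n c \<omega> t) (c t)
        - project_drift W h n (project_state W n d \<omega> t) (d t) \<le> max_gap"
      using drift_diff_le_project_gap[OF graph[OF assms(1)] graph[OF assms(2)]]
        project_gap_le_max_gap[of n] by linarith
  qed
  finally show ?thesis by simp
qed

lemma feasible_controls_iff_components:
  "a \<in> feasible_controls W \<omega> T \<longleftrightarrow> (\<lambda>n t. a t n) \<in> (\<Pi> n\<in>UNIV. project_controls W n \<omega> T) \<and>
    (\<forall>j\<in>{..T} \<times> UNIV. (\<Sum>n\<in>UNIV. component n (\<lambda>t. a t n) j) \<le> budget W $ snd j)"
  by (auto simp: feasible_controls_iff joint_controls_iff component_def less_eq_vec_def)

text \<open>
  For a fixed scenario and horizon, the agents are the projects, a choice is a control sequence, and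
  the resources are the pairs of a period and a constraint.
\<close>

sublocale separable_program "\<lambda>n. project_controls W n \<omega> T" component
  "\<lambda>n c. project_I W h n c \<omega> T" "\<lambda>j. budget W $ snd j" "{..T} \<times> UNIV" "real (T + 1) * max_gap"
proof
  obtain a where "a \<in> feasible_controls W \<omega> T"
    using feasible_controls_nonempty[OF feasible_action_exists scenario_model scenario] by blast
  then show "\<exists>x\<in>\<Pi> n\<in>UNIV. project_controls W n \<omega> T. \<forall>j\<in>{..T} \<times> UNIV.
      (\<Sum>n\<in>UNIV. component n (x n) j) \<le> budget W $ snd j"
    unfolding feasible_controls_iff_components by (intro bexI[of _ "\<lambda>n t. a t n"]) auto
qed (intro finite_SigmaI finite_atMost finite compact_components component_convex_like
    project_I_oscillation; assumption)+

text \<open>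
  What the constant \<open>\<theta>\<close> of the value function takes away from \<open>joint_I\<close>: each period adds it
  discounted and subtracts it undiscounted.
\<close>

definition offset :: real where
  "offset = real (T + 1) * ((1 - discount W) * \<theta>)"

lemma joint_I_eq:
  assumes "a \<in> joint_controls W \<omega> T"
  shows "joint_I W H a \<omega> T \<mu> = gain (\<lambda>n t. a t n)
    + (\<Sum>j\<in>{..T} \<times> UNIV. \<mu> (fst j) $ snd j * (budget W $ snd j - usage (\<lambda>n t. a t n) j)) - offset"
proof -
  have c: "(\<lambda>t. a t n) \<in> project_controls W n \<omega> T" for n
    using assms by (auto simp: joint_controls_iff)
  let ?x = "\<lambda>t n. project_state W n (\<lambda>s. a s n) \<omega> t"
  have graph: "(?x t n, a t n) \<in> project_graph W n" if "t \<le> T" for t n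
    using project_controls_graph[OF scenario_model scenario c that] .
  have summand: "joint_reward W (?x t) (a t) + discount W * (\<integral>y. H y \<partial>joint_kernel W (?x t) (a t)) - H (?x t)
      = (\<Sum>n\<in>UNIV. project_drift W h n (?x t n) (a t n)) - (1 - discount W) * \<theta>" if "t \<le> T" for t
  proof -
    have "?x t \<in> space (joint_states W)"
      using graph[OF that] by (auto simp: joint_states_def space_PiM project_graph_def)
    then show ?thesis
      using expectation_H[of "?x t" "a t"] graph[OF that]
      by (simp add: H_eq joint_reward_def project_drift_def sum.distrib sum_subtractf
          sum_distrib_left algebra_simps)
  qed
  have "joint_I W H a \<omega> T \<mu> = (\<Sum>t\<le>T. (\<Sum>n\<in>UNIV. project_drift W h n (?x t n) (a t n))
      - (1 - discount W) * \<theta> + \<mu> t \<bullet> (budget W - joint_cons W (?x t) (a t)))"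
    unfolding joint_I_def Let_def joint_state_def atLeast0AtMost
    by (intro sum.cong refl) (simp add: summand)
  also have "\<dots> = (\<Sum>t\<le>T. \<Sum>n\<in>UNIV. project_drift W h n (?x t n) (a t n)) - offset
      + (\<Sum>t\<le>T. \<mu> t \<bullet> (budget W - joint_cons W (?x t) (a t)))"
    by (simp add: sum.distrib sum_subtractf offset_def)
  also have "(\<Sum>t\<le>T. \<Sum>n\<in>UNIV. project_drift W h n (?x t n) (a t n)) = gain (\<lambda>n t. a t n)"
    unfolding gain_def unfolding project_I_def atLeast0AtMost by (rule sum.swap)
  also have "(\<Sum>t\<le>T. \<mu> t \<bullet> (budget W - joint_cons W (?x t) (a t)))
      = (\<Sum>t\<le>T. \<Sum>i\<in>UNIV. \<mu> t $ i * (budget W $ i - usage (\<lambda>n t. a t n) (t, i)))"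
    by (intro sum.cong refl)
      (simp add: inner_vec_def joint_cons_def usage_def component_def project_cons_at_def)
  also have "\<dots> = (\<Sum>j\<in>{..T} \<times> UNIV. \<mu> (fst j) $ snd j * (budget W $ snd j - usage (\<lambda>n t. a t n) j))"
    by (simp add: sum.cartesian_product split_beta)
  finally show ?thesis by simp
qed

lemma joint_I_bdd_above: "bdd_above ((\<lambda>a. joint_I W H a \<omega> T \<mu>) ` joint_controls W \<omega> T)"
proof -
  let ?\<Phi> = "\<lambda>u w. w + (\<Sum>j\<in>{..T} \<times> UNIV. \<mu> (fst j) $ snd j * (budget W $ snd j - u j)) - offset"
  have "continuous_on UNIV (\<lambda>z::(nat \<times> 'l \<Rightarrow> real) \<times> real. ?\<Phi> (fst z) (snd z))"
    by (intro continuous_intros continuous_on_product_then_coordinatewise[OF continuous_on_fst])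
  then have "compact ((\<lambda>x. ?\<Phi> (usage x) (gain x)) ` (\<Pi> n\<in>UNIV. project_controls W n \<omega> T))"
    by (rule compact_image_outcomes)
  then have "bdd_above ((\<lambda>x. ?\<Phi> (usage x) (gain x)) ` (\<Pi> n\<in>UNIV. project_controls W n \<omega> T))"
    by (intro bounded_imp_bdd_above compact_imp_bounded)
  moreover have "(\<lambda>a. joint_I W H a \<omega> T \<mu>) ` joint_controls W \<omega> T
      \<subseteq> (\<lambda>x. ?\<Phi> (usage x) (gain x)) ` (\<Pi> n\<in>UNIV. project_controls W n \<omega> T)"
    using joint_I_eq by (force simp: joint_controls_iff)
  ultimately show ?thesis by (rule bdd_above_mono)
qed

lemma feasible_subset_joint: "feasible_controls W \<omega> T \<subseteq> joint_controls W \<omega> T"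
  by (auto simp: feasible_controls_iff)

lemma feasible_nonempty: "feasible_controls W \<omega> T \<noteq> {}"
  by (rule feasible_controls_nonempty[OF feasible_action_exists scenario_model scenario])

lemma joint_I_le_exact_inner:
  assumes "a \<in> feasible_controls W \<omega> T"
  shows "joint_I W H a \<omega> T (\<lambda>_. 0) \<le> exact_inner W H \<omega> T"
  unfolding exact_inner_def
  using assms by (intro cSUP_upper bdd_above_mono[OF joint_I_bdd_above image_mono[OF feasible_subset_joint]])

lemma weak_duality_multiplier:
  assumes "\<mu> \<in> multipliers T"
  shows "exact_inner W H \<omega> T \<le> (SUP a \<in> joint_controls W \<omega> T. joint_I W H a \<omega> T \<mu>)"
  unfolding exact_inner_def
proof (rule cSUP_least[OF feasible_nonempty])
  fix a assume a: "a \<in> feasible_controls W \<omega> T"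
  then have joint: "a \<in> joint_controls W \<omega> T" using feasible_subset_joint by blast
  have "0 \<le> (\<Sum>j\<in>{..T} \<times> UNIV. \<mu> (fst j) $ snd j * (budget W $ snd j - usage (\<lambda>n t. a t n) j))"
    using assms a
    by (intro sum_nonneg mult_nonneg_nonneg)
      (auto simp: multipliers_def less_eq_vec_def feasible_controls_iff_components usage_def)
  then have "joint_I W H a \<omega> T (\<lambda>_. 0) \<le> joint_I W H a \<omega> T \<mu>"
    by (simp add: joint_I_eq[OF joint])
  also have "\<dots> \<le> (SUP a \<in> joint_controls W \<omega> T. joint_I W H a \<omega> T \<mu>)"
    by (intro cSUP_upper joint joint_I_bdd_above)
  finally show "joint_I W H a \<omega> T (\<lambda>_. 0) \<le> (SUP a \<in> joint_controls W \<omega> T. joint_I W H a \<omega> T \<mu>)" .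
qed

lemma weak_duality: "exact_inner W H \<omega> T \<le> practical_inner W H \<omega> T"
proof -
  have "(\<lambda>_. 0) \<in> (multipliers T :: (nat \<Rightarrow> real ^ 'l) set)" by (simp add: multipliers_def)
  then show ?thesis
    unfolding practical_inner_def by (intro cINF_greatest weak_duality_multiplier) auto
qed

text \<open>
  The abstract gap \<open>(card J + 1) * D\<close>, where \<open>card J = CARD('l) * (T + 1)\<close> and \<open>D = (T + 1) * max_gap\<close>. The
  abstract result needs a value that feasible controls miss strictly, hence the slack \<open>e\<close>.
\<close>

lemma duality_gap:
  "practical_inner W H \<omega> T
    \<le> exact_inner W H \<omega> T + (real CARD('l) * real (T + 1) + 1) * (real (T + 1) * max_gap)"
proof (rule field_le_epsilon)
  fix e :: real assume e: "0 < e"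
  define v where "v = exact_inner W H \<omega> T + offset + e"
  have "gain x < v" if x: "x \<in> (\<Pi> n\<in>UNIV. project_controls W n \<omega> T)"
    "\<forall>j\<in>{..T} \<times> UNIV. usage x j \<le> budget W $ snd j" for x
  proof -
    have a: "(\<lambda>t n. x n t) \<in> feasible_controls W \<omega> T"
      using x by (simp add: feasible_controls_iff_components usage_def)
    then have "gain x - offset = joint_I W H (\<lambda>t n. x n t) \<omega> T (\<lambda>_. 0)"
      using feasible_subset_joint by (subst joint_I_eq) auto
    then show ?thesis using joint_I_le_exact_inner[OF a] e by (simp add: v_def)
  qed
  then obtain \<mu> where \<mu>: "\<And>j. j \<in> {..T} \<times> UNIV \<Longrightarrow> 0 \<le> \<mu> j"
    and gap: "\<And>x. x \<in> (\<Pi> n\<in>UNIV. project_controls W n \<omega> T) \<Longrightarrow>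
      gain x + (\<Sum>j\<in>{..T} \<times> UNIV. \<mu> j * (budget W $ snd j - usage x j))
        \<le> v + (real (card ({..T} \<times> (UNIV :: 'l set))) + 1) * (real (T + 1) * max_gap)"
    using Lagrange_multipliers_duality_gap by blast
  define \<mu>' where "\<mu>' t = (if t \<le> T then \<chi> i. \<mu> (t, i) else 0)" for t
  have \<mu>': "\<mu>' \<in> multipliers T"
    using \<mu> by (auto simp: multipliers_def \<mu>'_def less_eq_vec_def)
  have "practical_inner W H \<omega> T \<le> (SUP a \<in> joint_controls W \<omega> T. joint_I W H a \<omega> T \<mu>')"
    unfolding practical_inner_def
    by (intro cINF_lower \<mu>' bdd_belowI2[OF weak_duality_multiplier])
  also have "\<dots> \<le> exact_inner W H \<omega> T + (real CARD('l) * real (T + 1) + 1) * (real (T + 1) * max_gap) + e"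
  proof (rule cSUP_least)
    show "joint_controls W \<omega> T \<noteq> {}" using feasible_nonempty feasible_subset_joint by blast
    fix a assume a: "a \<in> joint_controls W \<omega> T"
    have "(\<Sum>j\<in>{..T} \<times> UNIV. \<mu>' (fst j) $ snd j * (budget W $ snd j - usage (\<lambda>n t. a t n) j))
      = (\<Sum>j\<in>{..T} \<times> UNIV. \<mu> j * (budget W $ snd j - usage (\<lambda>n t. a t n) j))"
      by (intro sum.cong) (auto simp: \<mu>'_def)
    moreover have "real (card ({..T} \<times> (UNIV :: 'l set))) = real CARD('l) * real (T + 1)"
      by (simp add: card_cartesian_product algebra_simps)
    ultimately show "joint_I W H a \<omega> T \<mu>'
      \<le> exact_inner W H \<omega> T + (real CARD('l) * real (T + 1) + 1) * (real (T + 1) * max_gap) + e"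
      using gap[of "\<lambda>n t. a t n"] a by (simp add: joint_I_eq joint_controls_iff v_def)
  qed
  finally show "practical_inner W H \<omega> T
    \<le> exact_inner W H \<omega> T + (real CARD('l) * real (T + 1) + 1) * (real (T + 1) * max_gap) + e" .
qed

lemma exact_inner_abs_le:
  assumes "\<And>n. \<forall>(x, a) \<in> project_graph W n. \<bar>project_drift W h n x a\<bar> \<le> C n"
  shows "\<bar>exact_inner W H \<omega> T\<bar> \<le> real (T + 1) * ((\<Sum>n\<in>UNIV. C n) + \<bar>\<theta>\<bar>)" (is "_ \<le> ?K")
proof -
  have bound: "\<bar>joint_I W H a \<omega> T (\<lambda>_. 0)\<bar> \<le> ?K" if a: "a \<in> feasible_controls W \<omega> T" for a
  proof -
    have joint: "a \<in> joint_controls W \<omega> T" using a feasible_subset_joint by blast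
    have "\<bar>project_I W h n (\<lambda>t. a t n) \<omega> T\<bar> \<le> real (T + 1) * C n" for n
    proof -
      have "(\<lambda>t. a t n) \<in> project_controls W n \<omega> T"
        using joint by (auto simp: joint_controls_iff)
      note graph = project_controls_graph[OF scenario_model scenario this]
      have "\<bar>project_I W h n (\<lambda>t. a t n) \<omega> T\<bar> \<le> (\<Sum>t=0..T. C n)"
        unfolding project_I_def
        by (rule order.trans[OF sum_abs], rule sum_mono) (use assms[of n] graph in fastforce)
      then show ?thesis by simp
    qed
    then have "\<bar>gain (\<lambda>n t. a t n)\<bar> \<le> (\<Sum>n\<in>UNIV. real (T + 1) * C n)"
      unfolding gain_def by (intro order.trans[OF sum_abs] sum_mono)
    moreover have "\<bar>offset\<bar> \<le> real (T + 1) * (1 * \<bar>\<theta>\<bar>)"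
      unfolding offset_def abs_mult using discount by (intro mult_mono) auto
    ultimately show ?thesis
      by (simp add: joint_I_eq[OF joint] distrib_left flip: sum_distrib_left)
  qed
  obtain a where a: "a \<in> feasible_controls W \<omega> T" using feasible_nonempty by blast
  have "exact_inner W H \<omega> T \<le> ?K"
    unfolding exact_inner_def using bound by (intro cSUP_least feasible_nonempty) (auto simp: abs_le_iff)
  moreover have "- ?K \<le> exact_inner W H \<omega> T"
    using bound[OF a] joint_I_le_exact_inner[OF a] by linarith
  ultimately show ?thesis by (simp add: abs_le_iff)
qed

end

section \<open>Averaging over the scenario and the random time\<close>

text \<open>
  From \<open>(n + 1)\<^sup>2 = (n + 1) * (n + 2) - (n + 1)\<close> and the first two derivatives of the geometric series.
\<close>

lemma sums_Suc_power2_geometric: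
  fixes z :: real
  assumes "\<bar>z\<bar> < 1"
  shows "(\<lambda>n. (real (Suc n))\<^sup>2 * z ^ n) sums ((1 + z) / (1 - z) ^ 3)"
proof -
  have "(\<lambda>n. diffs (\<lambda>n. real (Suc n)) n * z ^ n) sums (2 / (1 - z) ^ 3)"
  proof (rule termdiffs_sums_strong[where K = 1])
    show "(\<lambda>n. real (Suc n) * y ^ n) sums (1 / (1 - y)\<^sup>2)" if "norm y < 1" for y :: real
      using geometric_deriv_sums[OF that] .
    have ne: "1 - z \<noteq> 0" using assms by auto
    then have cancel: "(2 - 2 * z) / ((1 - z) * (1 - z) * ((1 - z) * (1 - z))) = 2 / ((1 - z) * (1 - z) * (1 - z))"
      by (simp only: frac_eq_eq mult_eq_0_iff simp_thms) (simp add: algebra_simps)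
    from ne show "((\<lambda>y. 1 / (1 - y)\<^sup>2) has_field_derivative 2 / (1 - z) ^ 3) (at z)"
      by (auto intro!: derivative_eq_intros simp: power2_eq_square power3_eq_cube cancel)
  qed (use assms in simp)
  then have "(\<lambda>n. diffs (\<lambda>n. real (Suc n)) n * z ^ n - real (Suc n) * z ^ n)
      sums (2 / (1 - z) ^ 3 - 1 / (1 - z)\<^sup>2)"
    using assms by (intro sums_diff geometric_deriv_sums) auto
  moreover have "diffs (\<lambda>n. real (Suc n)) n * z ^ n - real (Suc n) * z ^ n = (real (Suc n))\<^sup>2 * z ^ n" for n
    by (simp add: diffs_def power2_eq_square algebra_simps)
  moreover have "2 / (1 - z) ^ 3 - 1 / (1 - z)\<^sup>2 = (1 + z) / (1 - z) ^ 3"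
  proof -
    have "1 - z \<noteq> 0" using assms by auto
    then have "1 / (1 - z)\<^sup>2 = (1 - z) / (1 - z) ^ 3" by (simp add: power2_eq_square power3_eq_cube)
    then show ?thesis by (simp add: diff_divide_distrib[symmetric])
  qed
  ultimately show ?thesis by simp
qed

lemma expectation_pmf_nat_sums:
  fixes f :: "nat \<Rightarrow> real"
  assumes "\<And>n. 0 \<le> f n" "(\<lambda>n. pmf p n * f n) sums S"
  shows "integrable (measure_pmf p) f" "measure_pmf.expectation p f = S"
proof -
  have "integrable (count_space UNIV) (\<lambda>n. pmf p n * f n)"
    using assms by (simp add: integrable_count_space_nat_iff sums_iff abs_mult)
  with assms(2) show "integrable (measure_pmf p) f" "measure_pmf.expectation p f = S"
    unfolding measure_pmf_eq_density
    by (simp_all add: integrable_density integral_density integral_count_space_nat sums_iff)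
qed

lemma geometric_pmf_moments:
  assumes "0 < \<beta>" "\<beta> < 1"
  shows "integrable (measure_pmf (geometric_pmf (1 - \<beta>))) (\<lambda>t. real (t + 1))"
    and "measure_pmf.expectation (geometric_pmf (1 - \<beta>)) (\<lambda>t. real (t + 1)) = 1 / (1 - \<beta>)"
    and "integrable (measure_pmf (geometric_pmf (1 - \<beta>))) (\<lambda>t. (real (t + 1))\<^sup>2)"
    and "measure_pmf.expectation (geometric_pmf (1 - \<beta>)) (\<lambda>t. (real (t + 1))\<^sup>2) = (1 + \<beta>) / (1 - \<beta>)\<^sup>2"
proof -
  have "(\<lambda>t. (1 - \<beta>) * (real (Suc t) * \<beta> ^ t)) sums ((1 - \<beta>) * (1 / (1 - \<beta>)\<^sup>2))"
    using assms by (intro sums_mult geometric_deriv_sums) auto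
  then have "(\<lambda>t. pmf (geometric_pmf (1 - \<beta>)) t * real (t + 1)) sums (1 / (1 - \<beta>))"
    using assms by (simp add: power2_eq_square mult.commute mult.left_commute)
  from expectation_pmf_nat_sums[OF _ this]
  show "integrable (measure_pmf (geometric_pmf (1 - \<beta>))) (\<lambda>t. real (t + 1))"
    "measure_pmf.expectation (geometric_pmf (1 - \<beta>)) (\<lambda>t. real (t + 1)) = 1 / (1 - \<beta>)" by simp_all
  have "(\<lambda>t. (1 - \<beta>) * ((real (Suc t))\<^sup>2 * \<beta> ^ t)) sums ((1 - \<beta>) * ((1 + \<beta>) / (1 - \<beta>) ^ 3))"
    using assms by (intro sums_mult sums_Suc_power2_geometric) auto
  moreover have "(1 - \<beta>) * ((1 + \<beta>) / (1 - \<beta>) ^ 3) = (1 + \<beta>) / (1 - \<beta>)\<^sup>2"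
    using assms by (simp add: power2_eq_square power3_eq_cube)
  ultimately have "(\<lambda>t. pmf (geometric_pmf (1 - \<beta>)) t * (real (t + 1))\<^sup>2) sums ((1 + \<beta>) / (1 - \<beta>)\<^sup>2)"
    using assms by (simp add: mult_ac)
  from expectation_pmf_nat_sums[OF _ this]
  show "integrable (measure_pmf (geometric_pmf (1 - \<beta>))) (\<lambda>t. (real (t + 1))\<^sup>2)"
    "measure_pmf.expectation (geometric_pmf (1 - \<beta>)) (\<lambda>t. (real (t + 1))\<^sup>2) = (1 + \<beta>) / (1 - \<beta>)\<^sup>2" by simp_all
qed

lemma distr_pair_prob_snd:
  assumes "prob_space M" "prob_space N"
  shows "distr (M \<Otimes>\<^sub>M N) N snd = N"
proof -
  interpret N: prob_space N by fact
  interpret M: prob_space M by fact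
  interpret pair_prob_space M N ..
  show ?thesis
  proof (rule measure_eqI)
    fix A assume "A \<in> sets (distr (M \<Otimes>\<^sub>M N) N snd)"
    then have A: "A \<in> sets N" by simp
    then have "emeasure (distr (M \<Otimes>\<^sub>M N) N snd) A = emeasure (M \<Otimes>\<^sub>M N) (space M \<times> A)"
      by (subst emeasure_distr)
        (auto intro!: arg_cong[where f = "emeasure _"] simp: space_pair_measure dest: sets.sets_into_space)
    then show "emeasure (distr (M \<Otimes>\<^sub>M N) N snd) A = emeasure N A"
      using A by (simp add: N.emeasure_pair_measure_Times M.emeasure_space_1)
  qed simp
qed

text \<open>
  It remains to average the scenariowise gap. Both inner values are integrable: the exact one grows at most
  linearly in the horizon, and the difference lies between \<open>0\<close> and the gap, which is quadratic in the
  horizon.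
\<close>

theorem theorem7:
  fixes W :: "('n::finite, 'x, 'a::euclidean_space, 'l::finite, 'w) wcdp"
    and \<kappa> :: "('n \<Rightarrow> 'x) \<Rightarrow> 'w measure"
    and h :: "'n \<Rightarrow> 'x \<Rightarrow> real"
    and H :: "('n \<Rightarrow> 'x) \<Rightarrow> real"
    and \<theta> :: real
  assumes "is_wcdp W"
    and "scenario_model W"
    and "scenario_law_given_initial W \<kappa>"
    and "\<And>n. h n \<in> borel_measurable (states W n)"
    and "\<And>n. \<exists>C. \<forall>x \<in> space (states W n). \<bar>h n x\<bar> \<le> C"
    and "\<And>x. x \<in> space (joint_states W) \<Longrightarrow> H x = \<theta> + (\<Sum>n\<in>UNIV. h n (x n))"
    and "\<And>T. (\<lambda>\<omega>. exact_inner W H \<omega> T) \<in> borel_measurable (scenarios W)"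
    and "\<And>T. (\<lambda>\<omega>. practical_inner W H \<omega> T) \<in> borel_measurable (scenarios W)"
    and "assumption1 W"
    and "\<And>\<omega> T. \<omega> \<in> space (scenarios W) \<Longrightarrow> assumption2 W h \<omega> T"
    and "\<And>\<omega> T. \<omega> \<in> space (scenarios W) \<Longrightarrow> assumption3 W \<omega> T"
  shows "\<forall>x \<in> space (joint_states W).
    practical_bound W \<kappa> H x - exact_bound W \<kappa> H x
      \<le> ((real CARD('l) - 1) * discount W + real CARD('l) + 1) / (1 - discount W)\<^sup>2
         * (MAX n. project_gap W h n)"
proof
  fix x assume x: "x \<in> space (joint_states W)"
  interpret separable_wcdp W h H \<theta>
    by unfold_locales (fact assms)+
  let ?\<beta> = "discount W"
  let ?G = "measure_pmf (geometric_pmf (1 - ?\<beta>))"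
  let ?M = "scenario_time_law W \<kappa> x"
  let ?L = "real CARD('l)"
  have \<kappa>: "prob_space (\<kappa> x)" "sets (\<kappa> x) = sets (scenarios W)"
    using measurable_space[OF _ x, of \<kappa> "prob_algebra (scenarios W)"] assms(3)
    by (auto simp: scenario_law_given_initial_def space_prob_algebra)
  have marginal: "distr ?M ?G snd = ?G"
    unfolding scenario_time_law_def by (intro distr_pair_prob_snd \<kappa> prob_space_measure_pmf)
  have snd_meas: "snd \<in> measurable ?M ?G" by (simp add: scenario_time_law_def)
  have "space ?M = space (scenarios W) \<times> UNIV"
    by (simp add: scenario_time_law_def space_pair_measure sets_eq_imp_space_eq[OF \<kappa>(2)])
  then have space_M: "fst z \<in> space (scenarios W)" if "z \<in> space ?M" for z
    using that by (simp add: mem_Times_iff)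
  have time_integral: "integrable ?M (\<lambda>z. f (snd z))" "(\<integral>z. f (snd z) \<partial>?M) = (\<integral>t. f t \<partial>?G)"
    if "integrable ?G f" for f :: "nat \<Rightarrow> real"
  proof -
    show "integrable ?M (\<lambda>z. f (snd z))"
      using that integrable_distr_eq[OF snd_meas, of f] by (simp add: marginal)
    show "(\<integral>z. f (snd z) \<partial>?M) = (\<integral>t. f t \<partial>?G)"
      using integral_distr[OF snd_meas, of f] by (simp add: marginal)
  qed
  have measurable_inner: "(\<lambda>z. f (fst z) (snd z)) \<in> borel_measurable ?M"
    if "\<And>T. (\<lambda>\<omega>. f \<omega> T) \<in> borel_measurable (scenarios W)" for f :: "'w \<Rightarrow> nat \<Rightarrow> real"
  proof (rule measurable_compose_countable[where f = "\<lambda>T z. f (fst z) T" and g = snd])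
    show "snd \<in> measurable ?M (count_space UNIV)"
      using snd_meas by (simp add: measurable_cong_sets[OF refl sets_measure_pmf_count_space])
    have "fst \<in> measurable ?M (scenarios W)"
      unfolding scenario_time_law_def
      using measurable_fst[of "\<kappa> x" ?G] by (simp add: measurable_cong_sets[OF refl \<kappa>(2)])
    then show "(\<lambda>z. f (fst z) T) \<in> borel_measurable ?M" for T
      using that by (rule measurable_compose)
  qed
  define gap where "gap t = (?L * real (t + 1) + 1) * (real (t + 1) * max_gap)" for t
  have gap_eq: "gap = (\<lambda>t. max_gap * (?L * (real (t + 1))\<^sup>2 + real (t + 1)))"
    by (auto simp: gap_def power2_eq_square algebra_simps)
  note moments = geometric_pmf_moments[OF discount]
  have gap_integrable: "integrable ?G gap"
    unfolding gap_eq by (intro integrable_mult_right Bochner_Integration.integrable_add moments)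
  have gap_integral: "(\<integral>t. gap t \<partial>?G) = max_gap * (?L * ((1 + ?\<beta>) / (1 - ?\<beta>)\<^sup>2) + 1 / (1 - ?\<beta>))"
    unfolding gap_eq using moments by simp
  have inner: "exact_inner W H \<omega> T \<le> practical_inner W H \<omega> T"
    "practical_inner W H \<omega> T \<le> exact_inner W H \<omega> T + gap T"
    if "\<omega> \<in> space (scenarios W)" for \<omega> T
  proof -
    interpret separable_wcdp_scenario W h H \<theta> \<omega> T
      by unfold_locales (fact that)
    show "exact_inner W H \<omega> T \<le> practical_inner W H \<omega> T" by (rule weak_duality)
    show "practical_inner W H \<omega> T \<le> exact_inner W H \<omega> T + gap T"
      unfolding gap_def by (rule duality_gap)
  qed
  obtain K where K: "\<And>\<omega> T. \<omega> \<in> space (scenarios W) \<Longrightarrow> \<bar>exact_inner W H \<omega> T\<bar> \<le> real (T + 1) * K"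
  proof -
    have "\<forall>n. \<exists>C. \<forall>(x, a) \<in> project_graph W n. \<bar>project_drift W h n x a\<bar> \<le> C"
      using drift_bounded by blast
    from choice[OF this] obtain C
      where C: "\<forall>n. \<forall>(x, a) \<in> project_graph W n. \<bar>project_drift W h n x a\<bar> \<le> C n" ..
    have "\<bar>exact_inner W H \<omega> T\<bar> \<le> real (T + 1) * ((\<Sum>n\<in>UNIV. C n) + \<bar>\<theta>\<bar>)"
      if \<omega>: "\<omega> \<in> space (scenarios W)" for \<omega> T
    proof -
      interpret separable_wcdp_scenario W h H \<theta> \<omega> T
        by unfold_locales (fact \<omega>)
      show ?thesis by (rule exact_inner_abs_le) (rule spec[OF C])
    qed
    then show thesis by (rule that)
  qed
  have exact_integrable: "integrable ?M (\<lambda>z. exact_inner W H (fst z) (snd z))"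
  proof (rule Bochner_Integration.integrable_bound)
    show "integrable ?M (\<lambda>z. real (snd z + 1) * K)"
      by (intro integrable_mult_left time_integral(1) moments)
    show "AE z in ?M. norm (exact_inner W H (fst z) (snd z)) \<le> norm (real (snd z + 1) * K)"
      using K space_M by (intro AE_I2) (simp, meson abs_ge_self order.trans)
  qed (intro measurable_inner assms(7))
  have diff_integrable: "integrable ?M (\<lambda>z. practical_inner W H (fst z) (snd z) - exact_inner W H (fst z) (snd z))"
  proof (rule Bochner_Integration.integrable_bound[OF time_integral(1)[OF gap_integrable]])
    show "AE z in ?M. norm (practical_inner W H (fst z) (snd z) - exact_inner W H (fst z) (snd z))
        \<le> norm (gap (snd z))"
    proof (rule AE_I2)
      fix z assume "z \<in> space ?M"
      from inner[OF space_M[OF this], of "snd z"]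
      show "norm (practical_inner W H (fst z) (snd z) - exact_inner W H (fst z) (snd z)) \<le> norm (gap (snd z))"
        by simp
    qed
  qed (intro borel_measurable_diff measurable_inner assms(7,8))
  have practical_integrable: "integrable ?M (\<lambda>z. practical_inner W H (fst z) (snd z))"
    using Bochner_Integration.integrable_add[OF diff_integrable exact_integrable] by simp
  have "practical_bound W \<kappa> H x - exact_bound W \<kappa> H x
      = (\<integral>z. practical_inner W H (fst z) (snd z) - exact_inner W H (fst z) (snd z) \<partial>?M)"
    unfolding practical_bound_def exact_bound_def split_beta
    using practical_integrable exact_integrable by simp
  also have "\<dots> \<le> (\<integral>z. gap (snd z) \<partial>?M)"
    using inner(2) space_M by (intro integral_mono diff_integrable time_integral(1) gap_integrable)
      (simp add: diff_le_eq add.commute)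
  also have "\<dots> = max_gap * (?L * ((1 + ?\<beta>) / (1 - ?\<beta>)\<^sup>2) + 1 / (1 - ?\<beta>))"
    by (simp only: time_integral(2)[OF gap_integrable] gap_integral)
  also have "?L * ((1 + ?\<beta>) / (1 - ?\<beta>)\<^sup>2) + 1 / (1 - ?\<beta>)
      = ((?L - 1) * ?\<beta> + ?L + 1) / (1 - ?\<beta>)\<^sup>2"
  proof -
    have "1 / (1 - ?\<beta>) = (1 - ?\<beta>) / (1 - ?\<beta>)\<^sup>2" using discount by (simp add: power2_eq_square)
    then show ?thesis by (simp add: algebra_simps flip: add_divide_distrib)
  qed
  finally show "practical_bound W \<kappa> H x - exact_bound W \<kappa> H x
      \<le> ((?L - 1) * ?\<beta> + ?L + 1) / (1 - ?\<beta>)\<^sup>2 * (MAX n. project_gap W h n)"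
    by (simp only: max_gap_def mult.commute)
qed

end
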